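(* Let $n=2^r$ with $r\ge2$, and let $G_1,G_2$ be two $\gamma$-matrices of order $n$, where $G_1=C_1+B_1$, $G_2=C_2+B_2$, with $C_l\in\mathcal C_n$, $B_l\in\mathcal B_n$, $l=1,2$. Then $$G_1G_2=\mathrm{circ}\Bigl(Q_n\bigl(\mathbf s^{(C_1,C_2)}+\mathbf s^{(B_1,B_2)}\bigr)\Bigr)+\mathrm{rcirc}\Bigl(Q_n\bigl(\mathbf s^{(C_1,B_2)}+\mathbf s^{(B_1,C_2)}\bigr)\Bigr).$$ Moreover, with the exception of the computation of the functions $\mathrm{circ}$ and $\mathrm{rcirc}$ (i.e. as regards the computation of the two vectors to which $\mathrm{circ}$ and $\mathrm{rcirc}$ are applied above), $G_1G_2$ can be computed by means of $\frac92\,n\log_2n+o(n\log_2n)$ additions and $\frac32\,n\log_2n+o(n\log_2n)$ multiplications.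
   Context: Rows, columns and vector components are indexed by $0,1,\dots,n-1$. $Q_n$ is the real $n\times n$ matrix whose columns $\mathbf q^{(0)},\dots,\mathbf q^{(n-1)}$ are as follows: $\mathbf q^{(0)}=\frac1{\sqrt n}(1,\dots,1)^T$; for $1\le j\le\lfloor\frac{n-1}2\rfloor$, $\mathbf q^{(j)}$ has $k$-th entry $\sqrt{2/n}\,\cos(2\pi kj/n)$ and $\mathbf q^{(n-j)}$ has $k$-th entry $\sqrt{2/n}\,\sin(2\pi kj/n)$, $k=0,\dots,n-1$; for $n$ even, $\mathbf q^{(n/2)}$ has $k$-th entry $(-1)^k/\sqrt n$. ($Q_n$ is orthogonal.) A vector $\mathbf x\in\mathbb R^n$ is symmetric (resp. asymmetric) if $x_j=x_{(n-j)\bmod n}$ (resp. $x_j=-x_{(n-j)\bmod n}$) for all $j$. A $\gamma$-matrix is an element of $\mathcal G_n=\{Q_n\,\mathrm{diag}(\boldsymbol\lambda)Q_n^T:\boldsymbol\lambda\in\mathbb R^n\}$; $\mathcal C_n$ (resp. $\mathcal B_n$) is the set of those with $\boldsymbol\lambda$ symmetric (resp. asymmetric). For $G=Q_n\,\mathrm{diag}(\boldsymbol\lambda)Q_n^T\in\mathcal G_n$ write $\lambda_j^{(G)}=\lambda_j$ (the eigenvalue with eigenvector $\mathbf q^{(j)}$). For $\mathbf c\in\mathbb R^n$, $\mathrm{circ}(\mathbf c)$ is the matrix with $(k,l)$ entry $c_{(l-k)\bmod n}$, and $\mathrm{rcirc}(\mathbf c)$ is the matrix with $(k,l)$ entry $c_{(k+l)\bmod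 n}$. With $\overline\alpha=1/\sqrt n$ and $\widetilde\alpha=\sqrt{2/n}$, for $G,G'\in\mathcal G_n$ the vector $\mathbf s^{(G,G')}\in\mathbb R^n$ has components $s_0=\overline\alpha\,\lambda_0^{(G)}\lambda_0^{(G')}$, $s_j=\widetilde\alpha\,\lambda_j^{(G)}\lambda_j^{(G')}$ for $1\le j\le n/2-1$, $s_{n/2}=\overline\alpha\,\lambda_{n/2}^{(G)}\lambda_{n/2}^{(G')}$, and $s_j=0$ for $j>n/2$ (it is the first column of $\mathrm{diag}(\boldsymbol\lambda^{(G)})\,\mathrm{diag}(\boldsymbol\lambda^{(G')})\,Q_n^T$). Cost model: real arithmetic operations (subtractions count as additions); $C_l$, $B_l$ are given through their first rows; constants depending only on $n$, such as $1/(2\cos(2\pi k/n))$ (and the analogous values for smaller powers of two), are assumed precomputed and stored. *)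

theory Defs
  imports Complex_Main "HOL-Library.Landau_Symbols" "Jordan_Normal_Form.Matrix"
begin

definition Q_mat :: "nat \<Rightarrow> real mat" where
  "Q_mat n = mat n n (\<lambda>(k, j).
     if j = 0 then 1 / sqrt (real n)
     else if j \<le> (n - 1) div 2 then sqrt (2 / real n) * cos (2 * pi * real k * real j / real n)
     else if 2 * j = n then (-1) ^ k / sqrt (real n)
     else sqrt (2 / real n) * sin (2 * pi * real k * real (n - j) / real n))"

definition symmetric_vec :: "real vec \<Rightarrow> bool" where
  "symmetric_vec x \<longleftrightarrow> (\<forall>j<dim_vec x. x $ j = x $ ((dim_vec x - j) mod dim_vec x))"

definition asymmetric_vec :: "real vec \<Rightarrow> bool" where
  "asymmetric_vec x \<longleftrightarrow> (\<forall>j<dim_vec x. x $ j = - x $ ((dim_vec x - j) mod dim_vec x))"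

definition gamma_mat :: "nat \<Rightarrow> real vec \<Rightarrow> real mat" where
  "gamma_mat n lam = Q_mat n * mat_diag n (($) lam) * (Q_mat n)\<^sup>T"

definition gamma_mats :: "nat \<Rightarrow> real mat set" where
  "gamma_mats n = {gamma_mat n lam | lam. lam \<in> carrier_vec n}"

definition sym_gamma_mats :: "nat \<Rightarrow> real mat set" where
  "sym_gamma_mats n = {gamma_mat n lam | lam. lam \<in> carrier_vec n \<and> symmetric_vec lam}"

definition asym_gamma_mats :: "nat \<Rightarrow> real mat set" where
  "asym_gamma_mats n = {gamma_mat n lam | lam. lam \<in> carrier_vec n \<and> asymmetric_vec lam}"

(* Meaningful for G in gamma_mats n only; the vector is then unique since Q_mat n is orthogonal. *)
definition gamma_eigvals :: "nat \<Rightarrow> real mat \<Rightarrow> real vec" where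
  "gamma_eigvals n G = (THE lam. lam \<in> carrier_vec n \<and> G = gamma_mat n lam)"

(* In both definitions dim_vec c is the order n of the matrix. In circ the term n is added so that
   the natural subtraction does not truncate: the index is (l - k) mod n. *)
definition circ :: "real vec \<Rightarrow> real mat" where
  "circ c = mat (dim_vec c) (dim_vec c) (\<lambda>(k, l). c $ ((l + dim_vec c - k) mod dim_vec c))"

definition rcirc :: "real vec \<Rightarrow> real mat" where
  "rcirc c = mat (dim_vec c) (dim_vec c) (\<lambda>(k, l). c $ ((k + l) mod dim_vec c))"

definition s_vec :: "nat \<Rightarrow> real mat \<Rightarrow> real mat \<Rightarrow> real vec" where
  "s_vec n G G' = vec n (\<lambda>j.
     if j = 0 \<or> 2 * j = n then 1 / sqrt (real n) * gamma_eigvals n G $ j * gamma_eigvals n G' $ j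
     else if 2 * j < n then sqrt (2 / real n) * gamma_eigvals n G $ j * gamma_eigvals n G' $ j
     else 0)"

(* Cost model: straight-line programs over the reals. The memory is a list holding the input
   followed by the results of the instructions executed so far; operands are addresses in it.
   Loading a constant is free (precomputed values), every arithmetic operation is counted,
   including operations having a constant as operand. *)
datatype instr = Const real | Add nat nat | Sub nat nat | Mul nat nat

fun instr_val :: "real list \<Rightarrow> instr \<Rightarrow> real" where
  "instr_val mem (Const c) = c"
| "instr_val mem (Add i j) = mem ! i + mem ! j"
| "instr_val mem (Sub i j) = mem ! i - mem ! j"
| "instr_val mem (Mul i j) = mem ! i * mem ! j"

fun instr_args :: "instr \<Rightarrow> nat set" where
  "instr_args (Const c) = {}"
| "instr_args (Add i j) = {i, j}"
| "instr_args (Sub i j) = {i, j}"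
| "instr_args (Mul i j) = {i, j}"

(* A program consists of its instructions and the addresses of its outputs. *)
type_synonym slp = "instr list \<times> nat list"

fun exec :: "instr list \<Rightarrow> real list \<Rightarrow> real list" where
  "exec [] mem = mem"
| "exec (i # is) mem = exec is (mem @ [instr_val mem i])"

(* With m inputs, instruction k refers only to the first m + k cells. *)
definition well_formed :: "nat \<Rightarrow> slp \<Rightarrow> bool" where
  "well_formed m P \<longleftrightarrow>
     (\<forall>k<length (fst P). \<forall>a\<in>instr_args (fst P ! k). a < m + k) \<and>
     (\<forall>a\<in>set (snd P). a < m + length (fst P))"

definition slp_output :: "slp \<Rightarrow> real list \<Rightarrow> real list" where
  "slp_output P xs = map (\<lambda>a. exec (fst P) xs ! a) (snd P)"

fun is_additive :: "instr \<Rightarrow> bool" where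
  "is_additive (Add i j) = True"
| "is_additive (Sub i j) = True"
| "is_additive _ = False"

fun is_multiplicative :: "instr \<Rightarrow> bool" where
  "is_multiplicative (Mul i j) = True"
| "is_multiplicative _ = False"

definition num_additions :: "slp \<Rightarrow> nat" where
  "num_additions P = length (filter is_additive (fst P))"

definition num_multiplications :: "slp \<Rightarrow> nat" where
  "num_multiplications P = length (filter is_multiplicative (fst P))"

definition first_row :: "real mat \<Rightarrow> real list" where
  "first_row A = list_of_vec (row A 0)"

end

theory Submission
  imports Defs "Jordan_Normal_Form.Determinant"
begin

text \<open>
  With $n = 2N$, orthogonality of $Q_n$ and the addition theorems give the entries of a
  $\gamma$-matrix in closed form; symmetric eigenvalues leave $\cos(\pi j(l-k)/N)$ and asymmetric
  ones $\cos(\pi j(k+l)/N)$, that is, a circulant and a reverse circulant matrix. In both cases the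
  first row is a cosine transform on $N+1$ points (DCT-I) of the eigenvalues, and vice versa. Hence
  four transforms give the eigenvalues of $C_1, B_1, C_2, B_2$, and two more give the result after
  $O(n)$ multiplications.

  The transform $X_k = \sum_{j \le N} x_j \cos(\pi jk/N)$ is computed by splitting the sum
  according to the parity of $j$: $X_k = E_k + O_k$ and $X_{N-k} = E_k - O_k$, where $E$ is a
  transform of half the size, and so is $2 \cos(\pi k/N) O_k$. For $N = 2^r$ this costs
  $\frac32 Nr + N + 1$ additions and $\frac12 Nr$ multiplications; six such transforms with
  $N = n/2$ give the leading terms $\frac92 n\log_2 n$ and $\frac32 n\log_2 n$.
\<close>

section \<open>Composing straight-line programs\<close>

primrec rename_instr :: "(nat \<Rightarrow> nat) \<Rightarrow> instr \<Rightarrow> instr" where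
  "rename_instr \<phi> (Const c) = Const c"
| "rename_instr \<phi> (Add i j) = Add (\<phi> i) (\<phi> j)"
| "rename_instr \<phi> (Sub i j) = Sub (\<phi> i) (\<phi> j)"
| "rename_instr \<phi> (Mul i j) = Mul (\<phi> i) (\<phi> j)"

lemma instr_args_rename [simp]: "instr_args (rename_instr \<phi> i) = \<phi> ` instr_args i"
  by (cases i) auto

lemma is_additive_rename [simp]: "is_additive \<circ> rename_instr \<phi> = is_additive"
proof
  show "(is_additive \<circ> rename_instr \<phi>) i = is_additive i" for i by (cases i) auto
qed

lemma is_multiplicative_rename [simp]:
  "is_multiplicative \<circ> rename_instr \<phi> = is_multiplicative"
proof
  show "(is_multiplicative \<circ> rename_instr \<phi>) i = is_multiplicative i" for i by (cases i) auto
qed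

lemma instr_val_rename:
  assumes "\<And>a. a \<in> instr_args i \<Longrightarrow> mem' ! \<phi> a = mem ! a"
  shows "instr_val mem' (rename_instr \<phi> i) = instr_val mem i"
  using assms by (cases i) auto

lemma length_exec [simp]: "length (exec p mem) = length mem + length p"
  by (induction p arbitrary: mem) auto

lemma exec_append: "exec (p @ q) mem = exec q (exec p mem)"
  by (induction p arbitrary: mem) auto

lemma nth_exec [simp]: "a < length mem \<Longrightarrow> exec p mem ! a = mem ! a"
  by (induction p arbitrary: mem) (auto simp: nth_append)

text \<open>Simulation, by induction on the program: each instruction appends one cell on both
  sides, so agreement along \<open>\<phi>\<close> persists as long as new cells go to new cells in
  the same order. Input cells may be mapped anywhere, several of them even to one cell; this lets a
  program read its inputs wherever an earlier program left them.\<close>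

lemma nth_exec_rename:
  assumes "\<And>k a. k < length p \<Longrightarrow> a \<in> instr_args (p ! k) \<Longrightarrow> a < length mem + k"
    and "\<And>a. a < length mem \<Longrightarrow> \<phi> a < length mem' \<and> mem' ! \<phi> a = mem ! a"
    and "\<And>k. k < length p \<Longrightarrow> \<phi> (length mem + k) = length mem' + k"
    and "a < length mem + length p"
  shows "exec (map (rename_instr \<phi>) p) mem' ! \<phi> a = exec p mem ! a"
  using assms
proof (induction p arbitrary: mem mem')
  case Nil
  then show ?case by simp
next
  case (Cons i p)
  have val: "instr_val mem' (rename_instr \<phi> i) = instr_val mem i"
  proof (rule instr_val_rename)
    fix a assume "a \<in> instr_args i"
    then show "mem' ! \<phi> a = mem ! a"
      using Cons.prems(1)[of 0 a] Cons.prems(2)[of a] by simp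
  qed
  have "exec (map (rename_instr \<phi>) p) (mem' @ [instr_val mem i]) ! \<phi> a
      = exec p (mem @ [instr_val mem i]) ! a"
  proof (rule Cons.IH)
    fix k b assume "k < length p" "b \<in> instr_args (p ! k)"
    then show "b < length (mem @ [instr_val mem i]) + k"
      using Cons.prems(1)[of "Suc k" b] by simp
  next
    fix b assume "b < length (mem @ [instr_val mem i])"
    then consider "b < length mem" | "b = length mem" by fastforce
    then show "\<phi> b < length (mem' @ [instr_val mem i]) \<and>
        (mem' @ [instr_val mem i]) ! \<phi> b = (mem @ [instr_val mem i]) ! b"
    proof cases
      case 1
      then show ?thesis using Cons.prems(2)[of b] by (simp add: nth_append)
    next
      case 2
      then show ?thesis using Cons.prems(3)[of 0] by simp
    qed
  next
    fix k assume "k < length p"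
    then show "\<phi> (length (mem @ [instr_val mem i]) + k) = length (mem' @ [instr_val mem i]) + k"
      using Cons.prems(3)[of "Suc k"] by simp
  next
    show "a < length (mem @ [instr_val mem i]) + length p"
      using Cons.prems(4) by simp
  qed
  then show ?case by (simp add: val)
qed

text \<open>Both costs are exact counts rather than bounds, so they add up under composition. The
  program is compared with \<open>f\<close> on inputs of length \<open>m\<close> only.\<close>

definition computes :: "nat \<Rightarrow> (real list \<Rightarrow> real list) \<Rightarrow> nat \<Rightarrow> nat \<Rightarrow> bool" where
  "computes m f a b \<longleftrightarrow> (\<exists>P. well_formed m P \<and> num_additions P = a \<and> num_multiplications P = b \<and>
     (\<forall>xs. length xs = m \<longrightarrow> slp_output P xs = f xs))"

lemma computes_cong:
  assumes "computes m f a b" "\<And>xs. length xs = m \<Longrightarrow> f xs = g xs" "a = a'" "b = b'"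
  shows "computes m g a' b'"
  using assms unfolding computes_def by metis

lemma computes_comp:
  assumes f: "computes m f a b" and g: "computes k g a' b'"
    and len: "\<And>xs. length xs = m \<Longrightarrow> length (f xs) = k"
  shows "computes m (\<lambda>xs. g (f xs)) (a + a') (b + b')"
proof -
  obtain p os where wfp: "well_formed m (p, os)"
    and a: "num_additions (p, os) = a" and b: "num_multiplications (p, os) = b"
    and outp: "\<And>xs. length xs = m \<Longrightarrow> slp_output (p, os) xs = f xs"
    using f unfolding computes_def by (metis surj_pair)
  obtain q us where wfq: "well_formed k (q, us)"
    and a': "num_additions (q, us) = a'" and b': "num_multiplications (q, us) = b'"
    and outq: "\<And>xs. length xs = k \<Longrightarrow> slp_output (q, us) xs = g xs"
    using g unfolding computes_def by (metis surj_pair)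
  \<comment> \<open>The output addresses are fixed in advance, so a single dummy input reveals their
    number.\<close>
  have los: "length os = k"
    using outp[of "replicate m 0"] len[of "replicate m 0"]
    by (metis length_map length_replicate slp_output_def snd_conv)
  have os_less: "os ! i < m + length p" if "i < k" for i
    using wfp that los unfolding well_formed_def by (metis fst_conv nth_mem snd_conv)
  \<comment> \<open>Inputs of \<open>q\<close> are looked up at the output cells of
    \<open>p\<close>; the cells written by \<open>q\<close> move behind those written by
    \<open>p\<close>.\<close>
  define \<phi> where "\<phi> i = (if i < k then os ! i else m + length p + (i - k))" for i
  have \<phi>_less: "\<phi> i < m + length p + t" if "i < k + t" for i t
    using os_less[of i] that by (auto simp: \<phi>_def)
  let ?P = "(p @ map (rename_instr \<phi>) q, map \<phi> us)"
  have "well_formed m ?P"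
    unfolding well_formed_def
  proof (intro conjI allI impI ballI)
    fix t x assume t: "t < length (fst ?P)" and x: "x \<in> instr_args (fst ?P ! t)"
    show "x < m + t"
    proof (cases "t < length p")
      case True
      then show ?thesis using wfp x by (simp add: well_formed_def nth_append)
    next
      case False
      define s where "s = t - length p"
      have s: "s < length q" "t = length p + s" using False t by (simp_all add: s_def)
      then obtain y where "y \<in> instr_args (q ! s)" "x = \<phi> y" using x by auto
      moreover from this have "y < k + s" using wfq s by (simp add: well_formed_def)
      ultimately show ?thesis using \<phi>_less[of y s] s by (simp add: add.assoc)
    qed
  next
    fix x assume "x \<in> set (snd ?P)"
    then obtain y where "y \<in> set us" "x = \<phi> y" by auto
    moreover from this have "y < k + length q" using wfq by (simp add: well_formed_def)
    ultimately show "x < m + length (fst ?P)" using \<phi>_less[of y "length q"] by (simp add: add.assoc)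
  qed
  moreover have "num_additions ?P = a + a'" "num_multiplications ?P = b + b'"
    using a b a' b' by (simp_all add: num_additions_def num_multiplications_def filter_map)
  moreover have "slp_output ?P xs = g (f xs)" if xs: "length xs = m" for xs
  proof -
    have fxs: "f xs = map ((!) (exec p xs)) os"
      using outp[OF xs] by (simp add: slp_output_def)
    have "exec (map (rename_instr \<phi>) q) (exec p xs) ! \<phi> i = exec q (f xs) ! i"
      if "i < k + length q" for i
    proof (rule nth_exec_rename)
      show "\<And>t a. t < length q \<Longrightarrow> a \<in> instr_args (q ! t) \<Longrightarrow> a < length (f xs) + t"
        using wfq len[OF xs] by (auto simp: well_formed_def)
      show "\<And>t. t < length q \<Longrightarrow> \<phi> (length (f xs) + t) = length (exec p xs) + t"
        using len[OF xs] xs by (simp add: \<phi>_def)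
      show "i < length (f xs) + length q" using that len[OF xs] by simp
      show "\<phi> i < length (exec p xs) \<and> exec p xs ! \<phi> i = f xs ! i" if "i < length (f xs)" for i
        using that len[OF xs] xs los os_less[of i] by (simp add: \<phi>_def fxs)
    qed
    then have "slp_output ?P xs = slp_output (q, us) (f xs)"
      using wfq unfolding slp_output_def well_formed_def by (simp add: exec_append)
    then show ?thesis using outq len xs by simp
  qed
  ultimately show ?thesis unfolding computes_def by blast
qed

text \<open>Memory cells are never overwritten, so the input can be listed among the outputs for
  free. This is how intermediate results are kept for later use.\<close>

lemma computes_extend:
  assumes "computes m f a b"
  shows "computes m (\<lambda>xs. xs @ f xs) a b"
proof -
  obtain p os where wfp: "well_formed m (p, os)"
    and a: "num_additions (p, os) = a" and b: "num_multiplications (p, os) = b"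
    and outp: "\<And>xs. length xs = m \<Longrightarrow> slp_output (p, os) xs = f xs"
    using assms unfolding computes_def by (metis surj_pair)
  let ?P = "(p, [0..<m] @ os)"
  have "well_formed m ?P" using wfp by (auto simp: well_formed_def)
  moreover have "num_additions ?P = a" "num_multiplications ?P = b"
    using a b by (simp_all add: num_additions_def num_multiplications_def)
  moreover have "slp_output ?P xs = xs @ f xs" if "length xs = m" for xs
    using that outp[OF that]
    by (auto simp: slp_output_def intro!: nth_equalityI)
  ultimately show ?thesis unfolding computes_def by blast
qed

text \<open>Outputs are mere addresses, so copying, permuting and discarding need no
  instruction.\<close>

lemma computes_select:
  assumes "\<And>i. i < k \<Longrightarrow> h i < m"
  shows "computes m (\<lambda>xs. map (\<lambda>i. xs ! h i) [0..<k]) 0 0"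
  unfolding computes_def using assms
  by (intro exI[of _ "([], map h [0..<k])"])
     (auto simp: well_formed_def num_additions_def num_multiplications_def slp_output_def)

lemma computes_take:
  assumes "k \<le> m"
  shows "computes m (take k) 0 0"
  by (rule computes_cong[OF computes_select[of k "\<lambda>i. i" m]])
     (use assms in \<open>auto intro!: nth_equalityI\<close>)

lemma computes_drop:
  assumes "k \<le> m"
  shows "computes m (drop k) 0 0"
  by (rule computes_cong[OF computes_select[of "m - k" "\<lambda>i. k + i" m]])
     (use assms in \<open>auto intro!: nth_equalityI\<close>)

lemma computes_length:
  assumes "computes m f a b"
  obtains k where "\<And>xs. length xs = m \<Longrightarrow> length (f xs) = k"
proof -
  obtain P where P: "\<And>xs. length xs = m \<Longrightarrow> slp_output P xs = f xs"
    using assms unfolding computes_def by blast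
  show thesis
    by (rule that[of "length (snd P)"]) (simp flip: P add: slp_output_def)
qed

text \<open>The input is kept beside the result of \<open>f\<close>, \<open>g\<close> then runs on
  the kept prefix, and finally the input is dropped.\<close>

lemma computes_append:
  assumes f: "computes m f a b" and g: "computes m g a' b'"
  shows "computes m (\<lambda>xs. f xs @ g xs) (a + a') (b + b')"
proof -
  obtain k where k: "\<And>xs. length xs = m \<Longrightarrow> length (f xs) = k"
    using computes_length[OF f] by blast
  obtain l where l: "\<And>xs. length xs = m \<Longrightarrow> length (g xs) = l"
    using computes_length[OF g] by blast
  have "computes (m + k) (\<lambda>ys. g (take m ys)) a' b'"
    using computes_comp[OF computes_take[of m "m + k"] g] by simp
  from computes_comp[OF computes_extend[OF f] computes_extend[OF this]]
  have "computes m (\<lambda>xs. xs @ f xs @ g xs) (a + a') (b + b')"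
    by (rule computes_cong) (auto simp: k)
  from computes_comp[OF this computes_drop[of m "m + k + l"]]
  show ?thesis by (rule computes_cong) (auto simp: k l)
qed

lemma computes_split:
  assumes f: "computes m f a b" and g: "computes k g a' b'"
  shows "computes (m + k) (\<lambda>xs. f (take m xs) @ g (drop m xs)) (a + a') (b + b')"
proof -
  have "computes (m + k) (\<lambda>xs. f (take m xs)) a b"
    using computes_comp[OF computes_take[of m "m + k"] f] by simp
  moreover have "computes (m + k) (\<lambda>xs. g (drop m xs)) a' b'"
    using computes_comp[OF computes_drop[of m "m + k"] g] by simp
  ultimately show ?thesis by (rule computes_append)
qed

text \<open>The entries share no work here. A subexpression common to several entries has to be
  computed and kept beforehand, as in \<open>computes_dct_merge\<close>.\<close>

lemma computes_map:
  assumes "\<And>i. i < k \<Longrightarrow> computes m (\<lambda>xs. [g i xs]) (a i) (b i)"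
  shows "computes m (\<lambda>xs. map (\<lambda>i. g i xs) [0..<k]) (\<Sum>i<k. a i) (\<Sum>i<k. b i)"
  using assms
proof (induction k)
  case 0
  show ?case using computes_select[of 0] by simp
next
  case (Suc k)
  then have "computes m (\<lambda>xs. map (\<lambda>i. g i xs) [0..<k]) (\<Sum>i<k. a i) (\<Sum>i<k. b i)" by simp
  from computes_append[OF this Suc.prems[of k]] show ?case by simp
qed

lemma computes_nth:
  assumes "i < m"
  shows "computes m (\<lambda>xs. [xs ! i]) 0 0"
  using computes_select[of 1 "\<lambda>_. i" m] assms by simp

lemma computes_const: "computes m (\<lambda>xs. [c]) 0 0"
  unfolding computes_def
  by (intro exI[of _ "([Const c], [m])"])
     (auto simp: well_formed_def num_additions_def num_multiplications_def slp_output_def)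

lemma computes_add:
  assumes "computes m (\<lambda>xs. [f xs]) a b" "computes m (\<lambda>xs. [g xs]) a' b'"
  shows "computes m (\<lambda>xs. [f xs + g xs]) (Suc (a + a')) (b + b')"
proof -
  have "computes 2 (\<lambda>xs. [xs ! 0 + xs ! 1]) 1 0"
    unfolding computes_def
    by (intro exI[of _ "([Add 0 1], [2])"])
       (auto simp: well_formed_def num_additions_def num_multiplications_def slp_output_def nth_append)
  from computes_comp[OF computes_append[OF assms] this] show ?thesis by simp
qed

lemma computes_diff:
  assumes "computes m (\<lambda>xs. [f xs]) a b" "computes m (\<lambda>xs. [g xs]) a' b'"
  shows "computes m (\<lambda>xs. [f xs - g xs]) (Suc (a + a')) (b + b')"
proof -
  have "computes 2 (\<lambda>xs. [xs ! 0 - xs ! 1]) 1 0"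
    unfolding computes_def
    by (intro exI[of _ "([Sub 0 1], [2])"])
       (auto simp: well_formed_def num_additions_def num_multiplications_def slp_output_def nth_append)
  from computes_comp[OF computes_append[OF assms] this] show ?thesis by simp
qed

lemma computes_mult:
  assumes "computes m (\<lambda>xs. [f xs]) a b" "computes m (\<lambda>xs. [g xs]) a' b'"
  shows "computes m (\<lambda>xs. [f xs * g xs]) (a + a') (Suc (b + b'))"
proof -
  have "computes 2 (\<lambda>xs. [xs ! 0 * xs ! 1]) 0 1"
    unfolding computes_def
    by (intro exI[of _ "([Mul 0 1], [2])"])
       (auto simp: well_formed_def num_additions_def num_multiplications_def slp_output_def nth_append)
  from computes_comp[OF computes_append[OF assms] this] show ?thesis by simp
qed

section \<open>The fast cosine transform\<close>

text \<open>This is the DCT-I with full instead of halved end terms, so that the odd half of the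
  recursion needs no doubling at its ends. The proper weights are applied outside, by
  \<open>end_weight\<close>.\<close>

definition dct :: "nat \<Rightarrow> real list \<Rightarrow> real list" where
  "dct N xs = map (\<lambda>k. \<Sum>j\<le>N. xs ! j * cos (pi * real j * real k / real N)) [0..<Suc N]"

lemma length_dct [simp]: "length (dct N xs) = Suc N"
  by (simp add: dct_def)

lemma nth_dct:
  "k \<le> N \<Longrightarrow> dct N xs ! k = (\<Sum>j\<le>N. xs ! j * cos (pi * real j * real k / real N))"
  by (simp add: dct_def del: upt_Suc)

lemma sum_even_odd:
  fixes f :: "nat \<Rightarrow> 'a::comm_monoid_add"
  shows "(\<Sum>j\<le>2 * N. f j) = (\<Sum>i\<le>N. f (2 * i)) + (\<Sum>i<N. f (2 * i + 1))"
  by (induction N) (simp_all add: ac_simps)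

definition dct_even :: "nat \<Rightarrow> real list \<Rightarrow> real list" where
  "dct_even N xs = map (\<lambda>i. xs ! (2 * i)) [0..<Suc N]"

text \<open>Coefficients of cos(pi i k / N) after the odd part has been multiplied by 2 cos(pi k /
  (2 N)): an interior node collects both odd neighbours, an end node only one. For
  \<open>N = 1\<close> both ends collect \<open>xs ! 1\<close>.\<close>

definition dct_odd :: "nat \<Rightarrow> real list \<Rightarrow> real list" where
  "dct_odd N xs = map (\<lambda>i. if i = 0 then xs ! 1 else if i = N then xs ! (2 * N - 1)
     else xs ! (2 * i - 1) + xs ! (2 * i + 1)) [0..<Suc N]"

lemma length_dct_even [simp]: "length (dct_even N xs) = Suc N"
  by (simp add: dct_even_def)

lemma length_dct_odd [simp]: "length (dct_odd N xs) = Suc N"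
  by (simp add: dct_odd_def)

lemma nth_dct_double:
  assumes "N > 0" "k \<le> 2 * N"
  shows "dct (2 * N) xs ! k = (\<Sum>i\<le>N. dct_even N xs ! i * cos (pi * real i * real k / real N))
    + (\<Sum>i<N. xs ! (2 * i + 1) * cos (pi * real (2 * i + 1) * real k / real (2 * N)))"
proof -
  have "dct (2 * N) xs ! k
      = (\<Sum>i\<le>N. xs ! (2 * i) * cos (pi * real (2 * i) * real k / real (2 * N)))
      + (\<Sum>i<N. xs ! (2 * i + 1) * cos (pi * real (2 * i + 1) * real k / real (2 * N)))"
    unfolding nth_dct[OF assms(2)] by (rule sum_even_odd)
  also have "(\<Sum>i\<le>N. xs ! (2 * i) * cos (pi * real (2 * i) * real k / real (2 * N)))
      = (\<Sum>i\<le>N. dct_even N xs ! i * cos (pi * real i * real k / real N))"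
    by (rule sum.cong) (simp_all add: dct_even_def mult.assoc del: upt_Suc)
  finally show ?thesis .
qed

text \<open>The product formula \<open>2 cos a cos b = cos (a - b) + cos (a + b)\<close> turns odd multiples of the angle
  into neighbouring even ones.\<close>

lemma dct_odd_part:
  assumes "N > 0"
  shows "2 * cos (pi * real k / real (2 * N))
      * (\<Sum>i<N. xs ! (2 * i + 1) * cos (pi * real (2 * i + 1) * real k / real (2 * N)))
    = (\<Sum>i\<le>N. dct_odd N xs ! i * cos (pi * real i * real k / real N))"
proof -
  define c where "c i = cos (pi * real i * real k / real N)" for i
  define x where "x i = xs ! (2 * i + 1)" for i
  obtain M where M: "N = Suc M" using assms gr0_implies_Suc by blast
  have prod: "2 * cos (pi * real k / real (2 * N)) * cos (pi * real (2 * i + 1) * real k / real (2 * N))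
      = c i + c (Suc i)" for i
  proof -
    have "pi * real (2 * i + 1) * real k / real (2 * N) - pi * real k / real (2 * N)
        = pi * real i * real k / real N"
      "pi * real (2 * i + 1) * real k / real (2 * N) + pi * real k / real (2 * N)
        = pi * real (Suc i) * real k / real N"
      using assms by (simp_all add: field_simps)
    then show ?thesis
      unfolding c_def using cos_times_cos[of "pi * real (2 * i + 1) * real k / real (2 * N)"
          "pi * real k / real (2 * N)"] by (simp add: mult_ac)
  qed
  have "2 * cos (pi * real k / real (2 * N))
      * (\<Sum>i<N. xs ! (2 * i + 1) * cos (pi * real (2 * i + 1) * real k / real (2 * N)))
      = (\<Sum>i<N. x i * (c i + c (Suc i)))"
    unfolding sum_distrib_left x_def prod[symmetric] by (simp add: mult_ac)
  also have "\<dots> = (\<Sum>i<Suc M. x i * c i) + (\<Sum>i<Suc M. x i * c (Suc i))"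
    by (simp add: M algebra_simps sum.distrib)
  also have "\<dots> = x 0 * c 0 + (\<Sum>i<M. (x i + x (Suc i)) * c (Suc i)) + x M * c N"
    unfolding sum.lessThan_Suc_shift[of "\<lambda>i. x i * c i" M]
    by (simp add: M algebra_simps sum.distrib)
  also have "\<dots> = (\<Sum>i\<le>N. dct_odd N xs ! i * c i)"
    unfolding M sum.atMost_Suc sum.atMost_shift
    by (simp add: dct_odd_def x_def del: upt_Suc)
  finally show ?thesis by (simp add: c_def)
qed

text \<open>For \<open>k < N\<close> the angle pi k / (2 N) stays below pi / 2, so the cosine factor
  in \<open>dct_odd_part\<close> is positive and can be divided out.\<close>

lemma nth_dct_double_less:
  assumes "k < N"
  shows "dct (2 * N) xs ! k = dct N (dct_even N xs) ! k
    + 1 / (2 * cos (pi * real k / real (2 * N))) * dct N (dct_odd N xs) ! k"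
proof -
  have "pi * real k / real (2 * N) < pi / 2"
    using assms by (simp add: field_simps)
  then have "cos (pi * real k / real (2 * N)) > 0"
    by (intro cos_gt_zero_pi) (auto intro: less_le_trans[of _ 0])
  then show ?thesis
    using assms dct_odd_part[of N k xs, symmetric]
    by (subst nth_dct_double) (simp_all add: nth_dct)
qed

text \<open>At this index the division would fail, but every odd cosine is taken at an odd multiple
  of pi / 2, so the odd part vanishes.\<close>

lemma nth_dct_double_mid:
  assumes "N > 0"
  shows "dct (2 * N) xs ! N = dct N (dct_even N xs) ! N"
proof -
  have "cos (pi * real (2 * i + 1) * real N / real (2 * N)) = 0" for i
  proof -
    have "pi * real (2 * i + 1) * real N / real (2 * N) = pi / 2 + real i * pi"
      using assms by (simp add: field_simps)
    then show ?thesis by (simp add: cos_add)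
  qed
  then show ?thesis using assms by (subst nth_dct_double) (simp_all add: nth_dct)
qed

text \<open>The reflection of \<open>k\<close> to \<open>2 * N - k\<close> preserves the even
  cosines and negates the odd ones, so the upper half reuses the values of the lower half.\<close>

lemma nth_dct_double_greater:
  assumes "k < N"
  shows "dct (2 * N) xs ! (2 * N - k) = dct N (dct_even N xs) ! k
    - 1 / (2 * cos (pi * real k / real (2 * N))) * dct N (dct_odd N xs) ! k"
proof -
  have even: "cos (pi * real i * real (2 * N - k) / real N) = cos (pi * real i * real k / real N)" for i
  proof -
    have "pi * real i * real (2 * N - k) / real N = real (2 * i) * pi - pi * real i * real k / real N"
      using assms by (simp add: of_nat_diff field_simps)
    then show ?thesis by (simp only: cos_diff cos_npi sin_npi) simp
  qed
  have odd: "cos (pi * real (2 * i + 1) * real (2 * N - k) / real (2 * N))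
      = - cos (pi * real (2 * i + 1) * real k / real (2 * N))" for i
  proof -
    have "pi * real (2 * i + 1) * real (2 * N - k) / real (2 * N)
        = real (2 * i + 1) * pi - pi * real (2 * i + 1) * real k / real (2 * N)"
      using assms by (simp add: of_nat_diff field_simps)
    then show ?thesis by (simp only: cos_diff cos_npi sin_npi) simp
  qed
  have "dct (2 * N) xs ! (2 * N - k)
      = (\<Sum>i\<le>N. dct_even N xs ! i * cos (pi * real i * real k / real N))
      - (\<Sum>i<N. xs ! (2 * i + 1) * cos (pi * real (2 * i + 1) * real k / real (2 * N)))"
    using assms by (subst nth_dct_double) (simp_all only: even odd, simp_all add: sum_negf)
  moreover have "dct (2 * N) xs ! k
      = (\<Sum>i\<le>N. dct_even N xs ! i * cos (pi * real i * real k / real N))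
      + (\<Sum>i<N. xs ! (2 * i + 1) * cos (pi * real (2 * i + 1) * real k / real (2 * N)))"
    using assms by (intro nth_dct_double) simp_all
  ultimately show ?thesis
    using nth_dct_double_less[OF assms, of xs] assms by (simp add: nth_dct)
qed

text \<open>Each product \<open>d xs k\<close> with \<open>k < N\<close> serves both the outputs
  \<open>k\<close> and \<open>2 * N - k\<close>; hence \<open>N\<close> multiplications suffice for
  \<open>2 * N + 1\<close> outputs.\<close>

lemma dct_double:
  assumes "N > 0"
  defines "e \<equiv> \<lambda>xs k. dct N (dct_even N xs) ! k"
    and "d \<equiv> \<lambda>xs k. 1 / (2 * cos (pi * real k / real (2 * N))) * dct N (dct_odd N xs) ! k"
  shows "dct (2 * N) xs = map (\<lambda>k. if k < N then e xs k + d xs k else if k = N then e xs N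
    else e xs (2 * N - k) - d xs (2 * N - k)) [0..<Suc (2 * N)]"
proof (rule nth_equalityI)
  fix k assume k: "k < length (dct (2 * N) xs)"
  consider "k < N" | "k = N" | "k > N" by linarith
  then show "dct (2 * N) xs ! k = map (\<lambda>k. if k < N then e xs k + d xs k else if k = N then e xs N
    else e xs (2 * N - k) - d xs (2 * N - k)) [0..<Suc (2 * N)] ! k"
  proof cases
    case 1
    then show ?thesis by (simp add: nth_dct_double_less e_def d_def del: upt_Suc)
  next
    case 2
    then show ?thesis using assms by (simp add: nth_dct_double_mid e_def del: upt_Suc)
  next
    case 3
    then show ?thesis using k nth_dct_double_greater[of "2 * N - k" N xs]
      by (simp add: e_def d_def del: upt_Suc)
  qed
qed simp

section \<open>Operation counts of the fast transform\<close>

primrec dct_additions :: "nat \<Rightarrow> nat" where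
  "dct_additions 0 = 2"
| "dct_additions (Suc r) = 2 * dct_additions r + (3 * 2 ^ r - 1)"

primrec dct_multiplications :: "nat \<Rightarrow> nat" where
  "dct_multiplications 0 = 0"
| "dct_multiplications (Suc r) = 2 * dct_multiplications r + 2 ^ r"

text \<open>The term 3 * 2^r of the recurrence adds 3/2 * 2^(r+1) at each level, which gives the
  leading term; the -1 has the constant solution 1, and the start value 2 fixes the coefficient of
  2^r.\<close>

lemma dct_additions_eq: "real (dct_additions r) = 3 / 2 * 2 ^ r * real r + 2 ^ r + 1"
proof (induction r)
  case (Suc r)
  have "real (3 * 2 ^ r - 1) = 3 * 2 ^ r - 1" by (simp add: of_nat_diff)
  then have "real (dct_additions (Suc r)) = 2 * real (dct_additions r) + (3 * 2 ^ r - 1)"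
    unfolding dct_additions.simps of_nat_add by simp
  then show ?case by (simp add: Suc.IH algebra_simps)
qed simp

lemma dct_multiplications_eq: "real (dct_multiplications r) = 1 / 2 * 2 ^ r * real r"
  by (induction r) (simp_all add: algebra_simps)

lemma computes_dct_split:
  assumes "N > 0"
  shows "computes (Suc (2 * N)) (\<lambda>xs. dct_even N xs @ dct_odd N xs) (N - 1) 0"
proof -
  have "computes (Suc (2 * N)) (dct_even N) 0 0"
    unfolding dct_even_def by (intro computes_select) simp
  moreover
  have "computes (Suc (2 * N)) (dct_odd N)
      (\<Sum>i<Suc N. if i = 0 \<or> i = N then 0 else 1) (\<Sum>i<Suc N. 0)"
    unfolding dct_odd_def
  proof (rule computes_map)
    fix i assume "i < Suc N"
    then show "computes (Suc (2 * N)) (\<lambda>xs. [if i = 0 then xs ! 1 else if i = N then xs ! (2 * N - 1)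
        else xs ! (2 * i - 1) + xs ! (2 * i + 1)]) (if i = 0 \<or> i = N then 0 else 1) 0"
      using assms computes_add[OF computes_nth computes_nth, of "2 * i - 1" "Suc (2 * N)" "2 * i + 1"]
      by (auto intro!: computes_nth)
  qed
  moreover have "(\<Sum>i<Suc N. if i = 0 \<or> i = N then 0 else 1) = N - 1"
  proof -
    have "{i \<in> {..<Suc N}. \<not> (i = 0 \<or> i = N)} = {1..<N}" by auto
    then show ?thesis by (simp add: sum.If_cases Int_def del: sum.lessThan_Suc)
  qed
  ultimately show ?thesis using computes_append by fastforce
qed

lemma computes_dct_merge:
  "computes (Suc N + Suc N) (\<lambda>zs. map (\<lambda>k. if k < N then zs ! k + c k * zs ! (Suc N + k)
      else if k = N then zs ! N
      else zs ! (2 * N - k) - c (2 * N - k) * zs ! (Suc N + (2 * N - k))) [0..<Suc (2 * N)]) (2 * N) N"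
  (is "computes ?m ?f _ _")
proof -
  \<comment> \<open>The scaled odd values are computed once and kept in the cells from
    \<open>?m\<close> on, because two outputs read each of them.\<close>
  have "computes ?m (\<lambda>zs. [c k * zs ! (Suc N + k)]) 0 1" if "k < N" for k
    using computes_mult[OF computes_const computes_nth, of "Suc N + k" ?m "c k"] that by simp
  from computes_extend[OF computes_map[where a = "\<lambda>_. 0" and b = "\<lambda>_. 1", OF this]]
  have scale: "computes ?m (\<lambda>zs. zs @ map (\<lambda>k. c k * zs ! (Suc N + k)) [0..<N]) 0 N"
    by simp
  have "computes (?m + N) (\<lambda>zs. map (\<lambda>k. if k < N then zs ! k + zs ! (?m + k)
      else if k = N then zs ! N
      else zs ! (2 * N - k) - zs ! (?m + (2 * N - k))) [0..<Suc (2 * N)])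
      (\<Sum>k<Suc (2 * N). if k = N then 0 else 1) (\<Sum>k<Suc (2 * N). 0)"
  proof (rule computes_map)
    fix k assume k: "k < Suc (2 * N)"
    consider "k < N" | "k = N" | "k > N" by linarith
    then show "computes (?m + N) (\<lambda>zs. [if k < N then zs ! k + zs ! (?m + k)
      else if k = N then zs ! N else zs ! (2 * N - k) - zs ! (?m + (2 * N - k))])
      (if k = N then 0 else 1) 0"
    proof cases
      case 1
      then show ?thesis
        using computes_add[OF computes_nth computes_nth, of k "?m + N" "?m + k"] by simp
    next
      case 2
      then show ?thesis using computes_nth[of N "?m + N"] by simp
    next
      case 3
      then show ?thesis
        using k computes_diff[OF computes_nth computes_nth, of "2 * N - k" "?m + N" "?m + (2 * N - k)"]
        by simp
    qed
  qed
  moreover have "(\<Sum>k<Suc (2 * N). if k = N then 0 else 1) = 2 * N"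
    using sum.remove[of "{..<Suc (2 * N)}" N "\<lambda>k. if k = N then 0 else 1 :: nat"]
    by (simp add: card_Diff_singleton del: sum.lessThan_Suc)
  ultimately have "computes (?m + N) (\<lambda>zs. map (\<lambda>k. if k < N then zs ! k + zs ! (?m + k)
      else if k = N then zs ! N
      else zs ! (2 * N - k) - zs ! (?m + (2 * N - k))) [0..<Suc (2 * N)]) (2 * N) 0" by simp
  from computes_comp[OF scale this] show ?thesis
    by (rule computes_cong) (auto simp: nth_append simp del: upt_Suc)
qed

lemma computes_dct:
  "computes (Suc (2 ^ r)) (dct (2 ^ r)) (dct_additions r) (dct_multiplications r)"
proof (induction r)
  case 0
  \<comment> \<open>For size 1 the only cosines are cos 0 = 1 and cos pi = -1, so one sum and one
    difference do.\<close>
  have "computes 2 (\<lambda>xs. [xs ! 0 + xs ! 1] @ [xs ! 0 - xs ! 1]) (1 + 1) (0 + 0)"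
    using computes_add[OF computes_nth computes_nth, of 0 2 1]
      computes_diff[OF computes_nth computes_nth, of 0 2 1]
    by (intro computes_append) simp_all
  then have "computes 2 (dct 1) 2 0"
    by (rule computes_cong) (simp_all add: dct_def)
  then show ?case by (simp add: numeral_2_eq_2)
next
  case (Suc r)
  let ?N = "2 ^ r :: nat"
  have N: "?N > 0" by simp
  from computes_comp[OF computes_comp[OF computes_dct_split[OF N] computes_split[OF Suc.IH Suc.IH]]
      computes_dct_merge[of ?N "\<lambda>k. 1 / (2 * cos (pi * real k / real (2 * ?N)))"]]
  \<comment> \<open>The split costs N - 1 additions and the merge 2 N, together 3 N - 1; the
    multiplications of this level are the N scalings in the merge.\<close>
  have "computes (Suc (2 * ?N)) (dct (2 * ?N))
     (?N - 1 + (dct_additions r + dct_additions r) + 2 * ?N)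
     (0 + (dct_multiplications r + dct_multiplications r) + ?N)"
    by (rule computes_cong)
       (auto simp: dct_double[OF N] nth_append simp del: upt_Suc)
  then show ?case
    unfolding power_Suc by (rule computes_cong) auto
qed

section \<open>\<gamma>-matrices\<close>

text \<open>For \<open>j \<le> N\<close> and \<open>N > 0\<close> this is the number of distinct
  residues among j and -j modulo 2 N: the frequencies 0 and N are their own mirror images.\<close>

definition end_weight :: "nat \<Rightarrow> nat \<Rightarrow> real" where
  "end_weight N j = (if j = 0 \<or> j = N then 1 else 2)"

lemma end_weight_nonneg [simp]: "end_weight N j \<ge> 0"
  by (simp add: end_weight_def)

lemma end_weight_neq_0 [simp]: "end_weight N j \<noteq> 0"
  by (simp add: end_weight_def)

section \<open>Folding sums along j and 2 N - j, and trigonometric identities\<close>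

lemma sum_double_fold:
  fixes f :: "nat \<Rightarrow> 'a::comm_monoid_add"
  assumes "N > 0"
  shows "(\<Sum>j<2 * N. f j) = (\<Sum>j\<le>N. f j) + (\<Sum>j\<in>{0<..<N}. f (2 * N - j))"
proof -
  have "{..<2 * N} = {..N} \<union> {N<..<2 * N}" "{..N} \<inter> {N<..<2 * N} = {}"
    using assms by auto
  then have "(\<Sum>j<2 * N. f j) = (\<Sum>j\<le>N. f j) + (\<Sum>j\<in>{N<..<2 * N}. f j)"
    by (simp add: sum.union_disjoint)
  also have "(\<Sum>j\<in>{N<..<2 * N}. f j) = (\<Sum>j\<in>{0<..<N}. f (2 * N - j))"
    by (rule sum.reindex_bij_witness[of _ "\<lambda>j. 2 * N - j" "\<lambda>j. 2 * N - j"]) auto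
  finally show ?thesis .
qed

lemma sum_atMost_ends:
  fixes g :: "nat \<Rightarrow> real"
  assumes "N > 0" "g 0 = 0" "g N = 0"
  shows "(\<Sum>j\<in>{0<..<N}. g j) = (\<Sum>j\<le>N. g j)"
  using assms by (intro sum.mono_neutral_left) (auto simp: not_less)

lemma sum_double_even:
  fixes f :: "nat \<Rightarrow> real"
  assumes "N > 0" "\<And>j. 0 < j \<Longrightarrow> j < N \<Longrightarrow> f (2 * N - j) = f j"
  shows "(\<Sum>j<2 * N. f j) = (\<Sum>j\<le>N. end_weight N j * f j)"
proof -
  \<comment> \<open>The weight minus one is 1 in the interior and 0 at both ends, so the mirrored
    terms can also be summed over all of \<open>{..N}\<close>.\<close>
  have "(\<Sum>j<2 * N. f j) = (\<Sum>j\<le>N. f j) + (\<Sum>j\<in>{0<..<N}. (end_weight N j - 1) * f j)"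
    using assms by (simp add: sum_double_fold end_weight_def)
  also have "(\<Sum>j\<in>{0<..<N}. (end_weight N j - 1) * f j) = (\<Sum>j\<le>N. (end_weight N j - 1) * f j)"
    using assms(1) by (intro sum_atMost_ends) (simp_all add: end_weight_def)
  finally show ?thesis by (simp add: algebra_simps sum_subtractf)
qed

lemma cos_periodic_mod:
  assumes "N > 0"
  shows "cos (pi * real j * real (a mod (2 * N)) / real N) = cos (pi * real j * real a / real N)"
proof -
  have "real a = real (2 * N) * real (a div (2 * N)) + real (a mod (2 * N))"
    by (simp flip: of_nat_mult of_nat_add)
  then have "pi * real j * real a / real N
      = real (2 * j * (a div (2 * N))) * pi + pi * real j * real (a mod (2 * N)) / real N"
    using assms by (simp add: field_simps)
  then show ?thesis by (simp only: cos_add cos_npi sin_npi) simp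
qed

lemma cos_reflect:
  assumes "N > 0" "l \<le> 2 * N"
  shows "cos (pi * real j * real (2 * N - l) / real N) = cos (pi * real j * real l / real N)"
proof -
  have "pi * real j * real (2 * N - l) / real N = real (2 * j) * pi - pi * real j * real l / real N"
    using assms by (simp add: of_nat_diff field_simps)
  then show ?thesis by (simp only: cos_diff cos_npi sin_npi) simp
qed

text \<open>Real part of the geometric sum of a 2 N-th root of unity, which differs from 1 because
  the bounds on \<open>m\<close> keep 2 N from dividing it.\<close>

lemma sum_cos_roots_of_unity:
  assumes "N > 0" "m \<noteq> 0" "\<bar>m\<bar> < 2 * int N"
  shows "(\<Sum>j<2 * N. cos (pi * real j * of_int m / real N)) = 0"
proof -
  let ?z = "cis (pi * of_int m / real N)"
  have "?z \<noteq> 1"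
  proof
    assume "?z = 1"
    then have "cos (pi * of_int m / real N) = 1" by (metis cis.simps(1) one_complex.simps(1))
    then obtain x :: int where "pi * of_int m / real N = of_int x * 2 * pi"
      by (auto simp: cos_one_2pi_int)
    then have "pi * (of_int m - of_int x * 2 * real N) = 0"
      using assms(1) by (simp add: field_simps)
    then have "of_int m = (of_int (x * 2 * int N) :: real)" by simp
    then have "m = x * 2 * int N" by (simp only: of_int_eq_iff)
    then have "\<bar>x\<bar> * (2 * int N) < 1 * (2 * int N)" "x \<noteq> 0"
      using assms by (auto simp: abs_mult)
    then show False by (simp only: mult_less_cancel_right) auto
  qed
  moreover have "?z ^ (2 * N) = 1"
  proof -
    have "real (2 * N) * (pi * of_int m / real N) = 2 * pi * of_int m"
      using assms(1) by simp
    then show ?thesis by (simp only: Complex.DeMoivre cis_multiple_2pi Ints_of_int)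
  qed
  ultimately have "(\<Sum>j<2 * N. ?z ^ j) = 0" by (simp add: sum_gp_strict)
  then have "Re (\<Sum>j<2 * N. ?z ^ j) = 0" by simp
  then show ?thesis by (simp add: Complex.DeMoivre mult_ac)
qed

section \<open>Entries and orthogonality of the matrix Q\<close>

lemma Q_mat_carrier [simp]: "Q_mat n \<in> carrier_mat n n"
  by (simp add: Q_mat_def)

lemma gamma_mat_carrier [simp]: "gamma_mat n lam \<in> carrier_mat n n"
  unfolding gamma_mat_def by (intro mult_carrier_mat[of _ n n]) (simp_all add: mat_diag_def)

lemma dim_Q_mat [simp]: "dim_row (Q_mat n) = n" "dim_col (Q_mat n) = n"
  using Q_mat_carrier[of n] by blast+

lemma dim_gamma_mat [simp]: "dim_row (gamma_mat n lam) = n" "dim_col (gamma_mat n lam) = n"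
  using gamma_mat_carrier[of n lam] by blast+

text \<open>The weight merges the three cosine-like cases of the definition: column 0 is cos 0, and
  column N is (-1)^k = cos(pi k).\<close>

lemma Q_mat_cos:
  assumes "k < 2 * N" "j \<le> N"
  shows "Q_mat (2 * N) $$ (k, j) = sqrt (end_weight N j / real (2 * N)) * cos (pi * real j * real k / real N)"
proof -
  consider "j = 0" | "0 < j" "j < N" | "0 < j" "j = N" using assms by linarith
  then show ?thesis
  proof cases
    case 1
    then show ?thesis using assms by (simp add: Q_mat_def end_weight_def real_sqrt_divide)
  next
    case 2
    then have "j \<le> (2 * N - 1) div 2" by simp
    moreover have "2 * pi * real k * real j / real (2 * N) = pi * real j * real k / real N"
      by simp
    ultimately show ?thesis using assms 2 by (simp add: Q_mat_def end_weight_def mult_ac)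
  next
    case 3
    then have "\<not> j \<le> (2 * N - 1) div 2" by simp
    moreover have "cos (pi * real j * real k / real N) = (-1) ^ k"
      using 3 cos_npi2[of k] by simp
    ultimately show ?thesis using assms 3 by (simp add: Q_mat_def end_weight_def real_sqrt_divide)
  qed
qed

lemma Q_mat_sin:
  assumes "k < 2 * N" "0 < j" "j < N"
  shows "Q_mat (2 * N) $$ (k, 2 * N - j)
    = sqrt (end_weight N j / real (2 * N)) * sin (pi * real j * real k / real N)"
proof -
  have "\<not> 2 * N - j \<le> (2 * N - 1) div 2" "2 * (2 * N - j) \<noteq> 2 * N" "2 * N - (2 * N - j) = j"
    using assms by auto
  then show ?thesis using assms by (simp add: Q_mat_def end_weight_def mult_ac)
qed

lemma gamma_mat_nth_sum:
  assumes "k < n" "l < n"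
  shows "gamma_mat n lam $$ (k, l) = (\<Sum>j<n. Q_mat n $$ (k, j) * lam $ j * Q_mat n $$ (l, j))"
proof -
  show ?thesis
    unfolding gamma_mat_def mat_diag_mult_right[OF Q_mat_carrier] using assms
    by (simp add: scalar_prod_def atLeast0LessThan)
qed

text \<open>Cosine column j is paired with sine column 2 N - j. At j = 0 and j = N the sines vanish,
  so the sine terms can be added there and one sum over \<open>{..N}\<close> covers everything. The
  \<open>mod\<close> keeps the index in range at j = 0 and matches the definitions of
  symmetry.\<close>

lemma gamma_mat_nth:
  assumes "k < 2 * N" "l < 2 * N"
  shows "gamma_mat (2 * N) lam $$ (k, l) = (\<Sum>j\<le>N. end_weight N j / real (2 * N) *
    (lam $ j * cos (pi * real j * real k / real N) * cos (pi * real j * real l / real N)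
     + lam $ ((2 * N - j) mod (2 * N)) * sin (pi * real j * real k / real N) * sin (pi * real j * real l / real N)))"
proof -
  have N: "N > 0" using assms by simp
  define c where "c k j = cos (pi * real j * real k / real N)" for k j
  define s where "s k j = sin (pi * real j * real k / real N)" for k j
  define a where "a j = end_weight N j / real (2 * N)" for j
  let ?f = "\<lambda>j. Q_mat (2 * N) $$ (k, j) * lam $ j * Q_mat (2 * N) $$ (l, j)"
  let ?g = "\<lambda>j. a j * (lam $ ((2 * N - j) mod (2 * N)) * s k j * s l j)"
  have sq: "sqrt (a j) * sqrt (a j) = a j" for j
    by (simp add: a_def)
  have "(\<Sum>j\<le>N. ?f j) = (\<Sum>j\<le>N. a j * (lam $ j * c k j * c l j))"
  proof (rule sum.cong)
    fix j assume "j \<in> {..N}"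
    then have "Q_mat (2 * N) $$ (k, j) = sqrt (a j) * c k j" "Q_mat (2 * N) $$ (l, j) = sqrt (a j) * c l j"
      using assms by (simp_all add: Q_mat_cos a_def c_def)
    then have "?f j = (sqrt (a j) * sqrt (a j)) * (lam $ j * c k j * c l j)"
      by (simp only: mult_ac)
    then show "?f j = a j * (lam $ j * c k j * c l j)" by (simp only: sq)
  qed simp
  moreover have "(\<Sum>j\<in>{0<..<N}. ?f (2 * N - j)) = (\<Sum>j\<in>{0<..<N}. ?g j)"
  proof (rule sum.cong)
    fix j assume j: "j \<in> {0<..<N}"
    then have "Q_mat (2 * N) $$ (k, 2 * N - j) = sqrt (a j) * s k j"
      "Q_mat (2 * N) $$ (l, 2 * N - j) = sqrt (a j) * s l j"
      using assms by (simp_all add: Q_mat_sin a_def s_def)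
    then have "?f (2 * N - j) = (sqrt (a j) * sqrt (a j)) * (lam $ (2 * N - j) * s k j * s l j)"
      by (simp only: mult_ac)
    moreover have "(2 * N - j) mod (2 * N) = 2 * N - j" using j by simp
    ultimately show "?f (2 * N - j) = ?g j" by (simp only: sq)
  qed simp
  moreover have "(\<Sum>j\<in>{0<..<N}. ?g j) = (\<Sum>j\<le>N. ?g j)"
    using N by (intro sum_atMost_ends) (simp_all add: s_def sin_npi2)
  ultimately have "gamma_mat (2 * N) lam $$ (k, l)
      = (\<Sum>j\<le>N. a j * (lam $ j * c k j * c l j)) + (\<Sum>j\<le>N. ?g j)"
    using assms N by (simp add: gamma_mat_nth_sum sum_double_fold)
  then show ?thesis
    by (simp add: sum.distrib[symmetric] a_def c_def s_def distrib_left)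
qed

text \<open>The product is the gamma-matrix with all eigenvalues 1. Its closed form collapses to
  cosines of the difference k - l, which unfold to a sum over all 2 N residues and vanish off the
  diagonal by \<open>sum_cos_roots_of_unity\<close>.\<close>

lemma Q_mat_orthogonal:
  assumes "N > 0"
  shows "Q_mat (2 * N) * (Q_mat (2 * N))\<^sup>T = 1\<^sub>m (2 * N)"
proof (rule eq_matI)
  fix k l assume "k < dim_row (1\<^sub>m (2 * N) :: real mat)" "l < dim_col (1\<^sub>m (2 * N) :: real mat)"
  then have kl: "k < 2 * N" "l < 2 * N" by auto
  define m where "m = int k - int l"
  let ?c = "\<lambda>j. cos (pi * real j * of_int m / real N)"
  have arg: "pi * real j * of_int m / real N = pi * real j * real k / real N - pi * real j * real l / real N" for j
    by (simp add: m_def right_diff_distrib diff_divide_distrib)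
  have "(Q_mat (2 * N) * (Q_mat (2 * N))\<^sup>T) $$ (k, l)
      = gamma_mat (2 * N) (vec (2 * N) (\<lambda>_. 1)) $$ (k, l)"
    using kl by (simp add: gamma_mat_nth_sum scalar_prod_def atLeast0LessThan)
  also have "\<dots> = (\<Sum>j\<le>N. end_weight N j / real (2 * N) * ?c j)"
    unfolding gamma_mat_nth[OF kl] arg cos_diff
    by (rule sum.cong) (use assms in simp_all)
  also have "\<dots> = (\<Sum>j\<le>N. end_weight N j * ?c j) / real (2 * N)"
    by (simp add: sum_divide_distrib)
  also have "(\<Sum>j\<le>N. end_weight N j * ?c j) = (\<Sum>j<2 * N. ?c j)"
  proof (rule sum_double_even[symmetric])
    fix j assume j: "0 < j" "j < N"
    have "pi * real (2 * N - j) * of_int m / real N = 2 * pi * of_int m - pi * real j * of_int m / real N"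
      using j by (simp add: of_nat_diff field_simps)
    then show "?c (2 * N - j) = ?c j"
      by (simp only: cos_diff cos_int_2pin sin_int_2pin mult_1 mult_zero_left add_0_right)
  qed fact
  also have "\<dots> / real (2 * N) = 1\<^sub>m (2 * N) $$ (k, l)"
  proof (cases "k = l")
    case True
    then show ?thesis using kl assms by (simp add: m_def)
  next
    case False
    then have "(\<Sum>j<2 * N. ?c j) = 0"
      using kl assms by (intro sum_cos_roots_of_unity) (auto simp: m_def)
    then show ?thesis using kl False by simp
  qed
  finally show "(Q_mat (2 * N) * (Q_mat (2 * N))\<^sup>T) $$ (k, l) = 1\<^sub>m (2 * N) $$ (k, l)" .
qed (simp_all add: Q_mat_def)

lemma Q_mat_orthogonal':
  assumes "N > 0"
  shows "(Q_mat (2 * N))\<^sup>T * Q_mat (2 * N) = 1\<^sub>m (2 * N)"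
  by (rule mat_mult_left_right_inverse[OF Q_mat_carrier _ Q_mat_orthogonal[OF assms]]) simp

lemma Q_mat_cancel:
  assumes "N > 0" "X \<in> carrier_mat (2 * N) (2 * N)"
  shows "(Q_mat (2 * N))\<^sup>T * (Q_mat (2 * N) * X) = X"
proof -
  have "(Q_mat (2 * N))\<^sup>T * (Q_mat (2 * N) * X) = ((Q_mat (2 * N))\<^sup>T * Q_mat (2 * N)) * X"
    by (rule assoc_mult_mat[symmetric]) (use assms in auto)
  then show ?thesis using assms by (simp add: Q_mat_orthogonal')
qed

section \<open>Algebra of gamma-matrices and uniqueness of eigenvalues\<close>

lemma gamma_mat_assoc: "gamma_mat n lam = Q_mat n * (mat_diag n (($) lam) * (Q_mat n)\<^sup>T)"
  unfolding gamma_mat_def by (rule assoc_mult_mat[of _ n n _ n _ n]) simp_all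

lemma gamma_mat_mult:
  assumes "N > 0"
  shows "gamma_mat (2 * N) a * gamma_mat (2 * N) b = gamma_mat (2 * N) (vec (2 * N) (\<lambda>j. a $ j * b $ j))"
proof -
  let ?n = "2 * N" and ?Q = "Q_mat (2 * N)"
  let ?A = "mat_diag ?n (($) a)" and ?B = "mat_diag ?n (($) b)"
  have BQ: "?B * ?Q\<^sup>T \<in> carrier_mat ?n ?n" and QA: "?Q * ?A \<in> carrier_mat ?n ?n"
    by (auto intro!: mult_carrier_mat[of _ ?n ?n])
  have "gamma_mat ?n a * gamma_mat ?n b = ?Q * ?A * ?Q\<^sup>T * (?Q * (?B * ?Q\<^sup>T))"
    unfolding gamma_mat_assoc[of _ b] by (simp add: gamma_mat_def)
  also have "\<dots> = ?Q * ?A * (?Q\<^sup>T * (?Q * (?B * ?Q\<^sup>T)))"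
    by (rule assoc_mult_mat[OF QA]) (use BQ in auto)
  also have "\<dots> = ?Q * ?A * (?B * ?Q\<^sup>T)"
    using Q_mat_cancel[OF assms BQ] by simp
  also have "\<dots> = ?Q * ?A * ?B * ?Q\<^sup>T"
    by (rule assoc_mult_mat[OF QA, symmetric]) auto
  also have "?Q * ?A * ?B = ?Q * (?A * ?B)"
    by (rule assoc_mult_mat[of _ ?n ?n _ ?n _ ?n]) auto
  also have "?A * ?B = mat_diag ?n (($) (vec ?n (\<lambda>j. a $ j * b $ j)))"
    unfolding mat_diag_diag by (rule eq_matI) (auto simp: mat_diag_def)
  finally show ?thesis by (simp add: gamma_mat_def)
qed

lemma gamma_mat_add:
  assumes "a \<in> carrier_vec n" "b \<in> carrier_vec n"
  shows "gamma_mat n a + gamma_mat n b = gamma_mat n (a + b)"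
proof (rule eq_matI)
  fix k l assume "k < dim_row (gamma_mat n (a + b))" "l < dim_col (gamma_mat n (a + b))"
  then have "k < n" "l < n" by simp_all
  then show "(gamma_mat n a + gamma_mat n b) $$ (k, l) = gamma_mat n (a + b) $$ (k, l)"
    using assms
    by (simp add: gamma_mat_nth_sum sum.distrib[symmetric] algebra_simps)
qed simp_all

text \<open>Conjugating back by Q recovers the diagonal matrix. This uniqueness is what makes the
  description in \<open>gamma_eigvals\<close> meaningful.\<close>

lemma gamma_mat_inj:
  assumes "N > 0" "a \<in> carrier_vec (2 * N)" "b \<in> carrier_vec (2 * N)"
    and eq: "gamma_mat (2 * N) a = gamma_mat (2 * N) b"
  shows "a = b"
proof -
  let ?n = "2 * N" and ?Q = "Q_mat (2 * N)"
  have diag: "?Q\<^sup>T * (gamma_mat ?n c * ?Q) = mat_diag ?n (($) c)" for c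
  proof -
    let ?C = "mat_diag ?n (($) c)"
    have QC: "?Q * ?C \<in> carrier_mat ?n ?n"
      by (auto intro!: mult_carrier_mat[of _ ?n ?n])
    have "gamma_mat ?n c * ?Q = ?Q * ?C * (?Q\<^sup>T * ?Q)"
      unfolding gamma_mat_def by (rule assoc_mult_mat[OF QC]) auto
    also have "\<dots> = ?Q * ?C"
      by (simp only: Q_mat_orthogonal'[OF assms(1)] right_mult_one_mat[OF QC])
    finally show ?thesis using Q_mat_cancel[OF assms(1), of ?C] by simp
  qed
  have diag_eq: "mat_diag ?n (($) a) = mat_diag ?n (($) b)"
    using diag[of a] diag[of b] eq by simp
  have "a $ j = b $ j" if "j < ?n" for j
    using arg_cong[OF diag_eq, of "\<lambda>M. M $$ (j, j)"] that by (simp add: mat_diag_def)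
  then show ?thesis using assms by (intro eq_vecI) auto
qed

lemma gamma_eigvals_gamma_mat:
  assumes "N > 0" "lam \<in> carrier_vec (2 * N)"
  shows "gamma_eigvals (2 * N) (gamma_mat (2 * N) lam) = lam"
  unfolding gamma_eigvals_def using assms gamma_mat_inj[OF assms(1)]
  by (intro the_equality) auto

section \<open>Cosine sums: circulant forms, first rows and inversion\<close>

definition cos_sum :: "nat \<Rightarrow> (nat \<Rightarrow> real) \<Rightarrow> nat \<Rightarrow> real" where
  "cos_sum N \<mu> k = (\<Sum>j\<le>N. end_weight N j / real (2 * N) * \<mu> j * cos (pi * real j * real k / real N))"

lemma cos_sum_mod: "N > 0 \<Longrightarrow> cos_sum N \<mu> (k mod (2 * N)) = cos_sum N \<mu> k"
  by (simp add: cos_sum_def cos_periodic_mod)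

lemma cos_sum_reflect: "N > 0 \<Longrightarrow> k \<le> 2 * N \<Longrightarrow> cos_sum N \<mu> (2 * N - k) = cos_sum N \<mu> k"
  by (simp add: cos_sum_def cos_reflect del: of_nat_diff)

text \<open>A vector supported on 0..N meets cosine columns only, and its factor sqrt(w / n) squares
  up with the equal factor in the column. Vectors from \<open>s_vec\<close> have this shape.\<close>

lemma Q_mat_mult_vec:
  assumes "N > 0"
  shows "Q_mat (2 * N) *\<^sub>v vec (2 * N) (\<lambda>j. if j \<le> N then sqrt (end_weight N j / real (2 * N)) * \<mu> j else 0)
    = vec (2 * N) (cos_sum N \<mu>)"
proof (rule eq_vecI)
  fix k assume "k < dim_vec (vec (2 * N) (cos_sum N \<mu>))"
  then have k: "k < 2 * N" by simp
  let ?s = "\<lambda>j. if j \<le> N then sqrt (end_weight N j / real (2 * N)) * \<mu> j else 0"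
  have "(Q_mat (2 * N) *\<^sub>v vec (2 * N) ?s) $ k = (\<Sum>j<2 * N. Q_mat (2 * N) $$ (k, j) * ?s j)"
    using k by (simp add: scalar_prod_def atLeast0LessThan)
  also have "\<dots> = (\<Sum>j\<le>N. Q_mat (2 * N) $$ (k, j) * ?s j)"
    using assms by (subst sum_double_fold) (auto intro!: sum.neutral)
  also have "\<dots> = cos_sum N \<mu> k"
    unfolding cos_sum_def
  proof (rule sum.cong)
    fix j assume "j \<in> {..N}"
    then have "Q_mat (2 * N) $$ (k, j) = sqrt (end_weight N j / real (2 * N)) * cos (pi * real j * real k / real N)"
      "?s j = sqrt (end_weight N j / real (2 * N)) * \<mu> j"
      using k by (simp_all add: Q_mat_cos)
    then have "Q_mat (2 * N) $$ (k, j) * ?s j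
        = (sqrt (end_weight N j / real (2 * N)) * sqrt (end_weight N j / real (2 * N)))
          * \<mu> j * cos (pi * real j * real k / real N)"
      by (simp only: mult_ac)
    moreover have "sqrt (end_weight N j / real (2 * N)) * sqrt (end_weight N j / real (2 * N))
        = end_weight N j / real (2 * N)" by simp
    ultimately show "Q_mat (2 * N) $$ (k, j) * ?s j
        = end_weight N j / real (2 * N) * \<mu> j * cos (pi * real j * real k / real N)"
      by (simp only:)
  qed simp
  finally show "(Q_mat (2 * N) *\<^sub>v vec (2 * N) ?s) $ k = vec (2 * N) (cos_sum N \<mu>) $ k"
    using k by simp
qed (simp add: Q_mat_def)

lemma s_vec_gamma_mat:
  assumes "N > 0" "a \<in> carrier_vec (2 * N)" "b \<in> carrier_vec (2 * N)"
  shows "s_vec (2 * N) (gamma_mat (2 * N) a) (gamma_mat (2 * N) b)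
    = vec (2 * N) (\<lambda>j. if j \<le> N then sqrt (end_weight N j / real (2 * N)) * (a $ j * b $ j) else 0)"
  using assms
  by (intro eq_vecI)
     (auto simp: s_vec_def gamma_eigvals_gamma_mat end_weight_def real_sqrt_divide real_sqrt_mult)

lemma Q_mat_mult_s_vec:
  assumes "N > 0" "a \<in> carrier_vec (2 * N)" "b \<in> carrier_vec (2 * N)"
    "c \<in> carrier_vec (2 * N)" "d \<in> carrier_vec (2 * N)"
  shows "Q_mat (2 * N) *\<^sub>v (s_vec (2 * N) (gamma_mat (2 * N) a) (gamma_mat (2 * N) b)
      + s_vec (2 * N) (gamma_mat (2 * N) c) (gamma_mat (2 * N) d))
    = vec (2 * N) (cos_sum N (\<lambda>j. a $ j * b $ j + c $ j * d $ j))"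
  unfolding Q_mat_mult_vec[OF assms(1), symmetric]
  using assms by (intro arg_cong2[where f = "(*\<^sub>v)"] refl eq_vecI) (auto simp: s_vec_gamma_mat distrib_left)

text \<open>Equal eigenvalues at j and 2 N - j give cos cos + sin sin, the cosine of the difference,
  so the entry depends on l - k only.\<close>

lemma gamma_mat_symmetric:
  assumes "N > 0" "a \<in> carrier_vec (2 * N)" "symmetric_vec a"
  shows "gamma_mat (2 * N) a = circ (vec (2 * N) (cos_sum N (($) a)))"
proof (rule eq_matI)
  fix k l assume "k < dim_row (circ (vec (2 * N) (cos_sum N (($) a))))"
    "l < dim_col (circ (vec (2 * N) (cos_sum N (($) a))))"
  then have kl: "k < 2 * N" "l < 2 * N" by (simp_all add: circ_def)
  have sym: "a $ ((2 * N - j) mod (2 * N)) = a $ j" if "j \<le> N" for j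
  proof -
    have "j < dim_vec a" using assms(1,2) that by simp
    with assms(3) have "a $ j = a $ ((dim_vec a - j) mod dim_vec a)"
      unfolding symmetric_vec_def by blast
    then show ?thesis using carrier_vecD[OF assms(2)] by simp
  qed
  have addition: "cos (pi * real j * real (l + 2 * N - k) / real N)
      = cos (pi * real j * real k / real N) * cos (pi * real j * real l / real N)
      + sin (pi * real j * real k / real N) * sin (pi * real j * real l / real N)" for j
  proof -
    have "pi * real j * real (l + 2 * N - k) / real N
        = real (2 * j) * pi - (pi * real j * real k / real N - pi * real j * real l / real N)"
      using kl assms(1) by (simp add: of_nat_diff field_simps)
    then show ?thesis
      by (simp only: cos_diff[of "real (2 * j) * pi"] cos_npi sin_npi) (simp add: cos_diff)
  qed
  have "gamma_mat (2 * N) a $$ (k, l) = cos_sum N (($) a) (l + 2 * N - k)"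
    unfolding gamma_mat_nth[OF kl] cos_sum_def addition
    by (rule sum.cong[OF refl], subst sym) (simp_all only: atMost_iff, simp add: distrib_left)
  moreover have "circ (vec (2 * N) (cos_sum N (($) a))) $$ (k, l) = cos_sum N (($) a) (l + 2 * N - k)"
    using kl assms(1) by (simp add: circ_def cos_sum_mod)
  ultimately show "gamma_mat (2 * N) a $$ (k, l) = circ (vec (2 * N) (cos_sum N (($) a))) $$ (k, l)"
    by simp
qed (simp_all add: circ_def)

text \<open>Opposite eigenvalues at j and 2 N - j give cos cos - sin sin, the cosine of the sum, so
  the entry depends on k + l only.\<close>

lemma gamma_mat_asymmetric:
  assumes "N > 0" "a \<in> carrier_vec (2 * N)" "asymmetric_vec a"
  shows "gamma_mat (2 * N) a = rcirc (vec (2 * N) (cos_sum N (($) a)))"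
proof (rule eq_matI)
  fix k l assume "k < dim_row (rcirc (vec (2 * N) (cos_sum N (($) a))))"
    "l < dim_col (rcirc (vec (2 * N) (cos_sum N (($) a))))"
  then have kl: "k < 2 * N" "l < 2 * N" by (simp_all add: rcirc_def)
  have asym: "a $ ((2 * N - j) mod (2 * N)) = - a $ j" if "j \<le> N" for j
  proof -
    have "j < dim_vec a" using assms(1,2) that by simp
    with assms(3) have "a $ j = - a $ ((dim_vec a - j) mod dim_vec a)"
      unfolding asymmetric_vec_def by blast
    then show ?thesis using carrier_vecD[OF assms(2)] by simp
  qed
  have addition: "cos (pi * real j * real (k + l) / real N)
      = cos (pi * real j * real k / real N) * cos (pi * real j * real l / real N)
      - sin (pi * real j * real k / real N) * sin (pi * real j * real l / real N)" for j
    by (simp add: distrib_left add_divide_distrib cos_add)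
  have "gamma_mat (2 * N) a $$ (k, l) = cos_sum N (($) a) (k + l)"
    unfolding gamma_mat_nth[OF kl] cos_sum_def addition
    by (rule sum.cong[OF refl], subst asym) (simp_all only: atMost_iff, simp add: distrib_left right_diff_distrib)
  moreover have "rcirc (vec (2 * N) (cos_sum N (($) a))) $$ (k, l) = cos_sum N (($) a) (k + l)"
    using kl assms(1) by (simp add: rcirc_def cos_sum_mod)
  ultimately show "gamma_mat (2 * N) a $$ (k, l) = rcirc (vec (2 * N) (cos_sum N (($) a))) $$ (k, l)"
    by simp
qed (simp_all add: rcirc_def)

text \<open>In row 0 every sine is 0 and every cosine is 1, so only the eigenvalues with index at
  most N enter.\<close>

lemma first_row_gamma_mat:
  assumes "N > 0"
  shows "first_row (gamma_mat (2 * N) a) = map (cos_sum N (($) a)) [0..<2 * N]"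
proof (rule nth_equalityI)
  show "length (first_row (gamma_mat (2 * N) a)) = length (map (cos_sum N (($) a)) [0..<2 * N])"
    by (simp add: first_row_def)
  fix l assume "l < length (first_row (gamma_mat (2 * N) a))"
  then have "l < 2 * N" by (simp add: first_row_def)
  then show "first_row (gamma_mat (2 * N) a) ! l = map (cos_sum N (($) a)) [0..<2 * N] ! l"
    using assms by (simp add: first_row_def list_of_vec_index gamma_mat_nth cos_sum_def mult.assoc)
qed

text \<open>Orthonormality of the cosine columns of Q, with the sum over 2 N rows folded by the
  reflection symmetry of the cosines.\<close>

lemma cos_orthogonal:
  assumes "N > 0" "j \<le> N" "k \<le> N"
  shows "(\<Sum>l\<le>N. end_weight N l * (cos (pi * real j * real l / real N) * cos (pi * real k * real l / real N)))
    = (if j = k then real (2 * N) / end_weight N j else 0)"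
proof -
  let ?Q = "Q_mat (2 * N)"
  let ?c = "\<lambda>l. cos (pi * real j * real l / real N) * cos (pi * real k * real l / real N)"
  let ?r = "sqrt (end_weight N j / real (2 * N)) * sqrt (end_weight N k / real (2 * N))"
  have "(if j = k then 1 else 0) = (?Q\<^sup>T * ?Q) $$ (j, k)"
    using assms by (simp add: Q_mat_orthogonal')
  also have "\<dots> = (\<Sum>l<2 * N. ?Q $$ (l, j) * ?Q $$ (l, k))"
    using assms by (simp add: scalar_prod_def atLeast0LessThan)
  also have "\<dots> = (\<Sum>l<2 * N. ?r * ?c l)"
    using assms by (intro sum.cong) (simp_all add: Q_mat_cos)
  also have "\<dots> = ?r * (\<Sum>l\<le>N. end_weight N l * ?c l)"
    unfolding sum_distrib_left[symmetric] using assms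
    by (subst sum_double_even) (simp_all add: cos_reflect del: of_nat_diff)
  finally have eq: "(if j = k then 1 else 0) = ?r * (\<Sum>l\<le>N. end_weight N l * ?c l)" .
  show ?thesis
  proof (cases "j = k")
    case True
    then have "?r = end_weight N j / real (2 * N)" by simp
    then show ?thesis using eq True assms(1) by (simp add: field_simps)
  next
    case False
    moreover have "?r \<noteq> 0" using assms(1) by simp
    ultimately show ?thesis using eq by simp
  qed
qed

text \<open>Up to weights the DCT-I is its own inverse. So one more transform of a first row returns
  the eigenvalues.\<close>

lemma cos_sum_inverse:
  assumes "N > 0" "k \<le> N"
  shows "(\<Sum>l\<le>N. end_weight N l * cos_sum N \<mu> l * cos (pi * real l * real k / real N)) = \<mu> k"
proof -
  let ?c = "\<lambda>j l. cos (pi * real j * real l / real N)"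
  have "(\<Sum>l\<le>N. end_weight N l * cos_sum N \<mu> l * ?c l k)
      = (\<Sum>l\<le>N. \<Sum>j\<le>N. end_weight N j / real (2 * N) * \<mu> j * (end_weight N l * (?c j l * ?c k l)))"
    by (simp add: cos_sum_def sum_distrib_left sum_distrib_right mult_ac)
  also have "\<dots> = (\<Sum>j\<le>N. end_weight N j / real (2 * N) * \<mu> j * (\<Sum>l\<le>N. end_weight N l * (?c j l * ?c k l)))"
    by (subst sum.swap) (simp add: sum_distrib_left)
  also have "\<dots> = (\<Sum>j\<le>N. if j = k then \<mu> k else 0)"
    using assms by (intro sum.cong) (auto simp: cos_orthogonal)
  also have "\<dots> = \<mu> k" using assms by simp
  finally show ?thesis .
qed

section \<open>Products of \<gamma>-matrices\<close>

lemma cos_sum_cong: "(\<And>j. j \<le> N \<Longrightarrow> \<mu> j = \<nu> j) \<Longrightarrow> cos_sum N \<mu> = cos_sum N \<nu>"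
  by (auto simp: cos_sum_def fun_eq_iff)

text \<open>\<open>q\<close> selects one of the concatenated first rows, each of length 2 N. By
  \<open>cos_sum_inverse\<close> the result is the list of eigenvalues 0..N, exactly those that
  enter the vectors s.\<close>

definition eigval_list :: "nat \<Rightarrow> nat \<Rightarrow> real list \<Rightarrow> real list" where
  "eigval_list N q xs = dct N (map (\<lambda>j. end_weight N j * xs ! (q * (2 * N) + j)) [0..<Suc N])"

text \<open>The four selectors name blocks of N + 1 eigenvalues. The transform yields entries 0..N
  of the resulting vector; the others are copies, by \<open>cos_sum_reflect\<close>, and cost
  nothing.\<close>

definition product_list :: "nat \<Rightarrow> nat \<Rightarrow> nat \<Rightarrow> nat \<Rightarrow> nat \<Rightarrow> real list \<Rightarrow> real list" where
  "product_list N p q p' q' ys =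
    (let zs = dct N (map (\<lambda>j. end_weight N j / real (2 * N)
        * (ys ! (p * Suc N + j) * ys ! (q * Suc N + j) + ys ! (p' * Suc N + j) * ys ! (q' * Suc N + j))) [0..<Suc N])
     in map (\<lambda>k. zs ! (if k \<le> N then k else 2 * N - k)) [0..<2 * N])"

lemma computes_dct_map:
  assumes "\<And>j. j < Suc (2 ^ r) \<Longrightarrow> computes m (\<lambda>xs. [f j xs]) a b"
  shows "computes m (\<lambda>xs. dct (2 ^ r) (map (\<lambda>j. f j xs) [0..<Suc (2 ^ r)]))
    (Suc (2 ^ r) * a + dct_additions r) (Suc (2 ^ r) * b + dct_multiplications r)"
proof -
  have "computes m (\<lambda>xs. map (\<lambda>j. f j xs) [0..<Suc (2 ^ r)])
      (\<Sum>j<Suc (2 ^ r). a) (\<Sum>j<Suc (2 ^ r). b)"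
    by (rule computes_map) (rule assms)
  from computes_comp[OF this computes_dct] show ?thesis
    by (rule computes_cong) (simp_all del: upt_Suc)
qed

lemma computes_eigval_list:
  assumes "q < 4"
  shows "computes (4 * (2 * 2 ^ r)) (eigval_list (2 ^ r) q)
    (dct_additions r) (Suc (2 ^ r) + dct_multiplications r)"
proof -
  have "computes (4 * (2 * 2 ^ r)) (\<lambda>xs. [end_weight (2 ^ r) j * xs ! (q * (2 * 2 ^ r) + j)]) 0 1"
    if "j < Suc (2 ^ r)" for j
  proof -
    have "(2 ^ r :: nat) \<ge> 1" by simp
    then have "j < 2 * 2 ^ r" using that by linarith
    moreover have "q * (2 * 2 ^ r) + 2 * 2 ^ r \<le> 4 * (2 * 2 ^ r)"
      using mult_le_mono1[of "Suc q" 4 "2 * 2 ^ r"] assms by simp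
    ultimately have "q * (2 * 2 ^ r) + j < 4 * (2 * 2 ^ r)" by linarith
    from computes_mult[OF computes_const computes_nth[OF this]] show ?thesis by simp
  qed
  from computes_dct_map[OF this] show ?thesis
    unfolding eigval_list_def by (rule computes_cong) simp_all
qed

lemma computes_product_list:
  assumes "p < 4" "q < 4" "p' < 4" "q' < 4"
  shows "computes (4 * Suc (2 ^ r)) (product_list (2 ^ r) p q p' q')
    (Suc (2 ^ r) + dct_additions r) (3 * Suc (2 ^ r) + dct_multiplications r)"
proof -
  let ?N = "2 ^ r :: nat"
  have less: "i * Suc ?N + j < 4 * Suc ?N" if "i < 4" "j < Suc ?N" for i j
    using mult_le_mono1[of "Suc i" 4 "Suc ?N"] that by simp
  have "computes (4 * Suc ?N) (\<lambda>ys. [end_weight ?N j / real (2 * ?N)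
        * (ys ! (p * Suc ?N + j) * ys ! (q * Suc ?N + j) + ys ! (p' * Suc ?N + j) * ys ! (q' * Suc ?N + j))]) 1 3"
    if "j < Suc ?N" for j
  proof -
    note nth = computes_nth[OF less[OF _ that]]
    have "computes (4 * Suc ?N) (\<lambda>ys. [ys ! (i * Suc ?N + j) * ys ! (l * Suc ?N + j)]) 0 1"
      if "i < 4" "l < 4" for i l
      using computes_mult[OF nth[OF that(1)] nth[OF that(2)]] by simp
    from computes_mult[OF computes_const[of _ "end_weight ?N j / real (2 * ?N)"] computes_add[OF this[OF assms(1,2)] this[OF assms(3,4)]]]
    show ?thesis by (rule computes_cong) (simp_all add: mult.commute)
  qed
  from computes_dct_map[OF this]
  have transform: "computes (4 * Suc ?N) (\<lambda>ys. dct ?N (map (\<lambda>j. end_weight ?N j / real (2 * ?N)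
        * (ys ! (p * Suc ?N + j) * ys ! (q * Suc ?N + j) + ys ! (p' * Suc ?N + j) * ys ! (q' * Suc ?N + j)))
        [0..<Suc ?N])) (Suc ?N + dct_additions r) (3 * Suc ?N + dct_multiplications r)"
    by (rule computes_cong) (simp_all add: mult.commute)
  have "computes (Suc ?N) (\<lambda>zs. map (\<lambda>k. zs ! (if k \<le> ?N then k else 2 * ?N - k)) [0..<2 * ?N]) 0 0"
    by (rule computes_select) auto
  from computes_comp[OF transform this] show ?thesis
    by (rule computes_cong) (simp_all add: product_list_def Let_def del: upt_Suc)
qed

text \<open>Blocks 0, 1, 2, 3 belong to C1, B1, C2, B2. Hence the selectors 0 2 1 3 stand for C1 C2
  + B1 B2, and 0 3 1 2 for C1 B2 + B1 C2.\<close>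

definition gamma_product_list :: "nat \<Rightarrow> real list \<Rightarrow> real list" where
  "gamma_product_list N xs =
    (let ys = eigval_list N 0 xs @ eigval_list N 1 xs @ eigval_list N 2 xs @ eigval_list N 3 xs
     in product_list N 0 2 1 3 ys @ product_list N 0 3 1 2 ys)"

text \<open>Four transforms for the eigenvalues and two for the results. The weights of the inputs
  cost 4 (N + 1) multiplications; in each result every index takes two products, one sum and one
  scaling.\<close>

lemma computes_gamma_product_list:
  "computes (4 * (2 * 2 ^ r)) (gamma_product_list (2 ^ r))
    (6 * dct_additions r + 2 * Suc (2 ^ r)) (6 * dct_multiplications r + 10 * Suc (2 ^ r))"
proof -
  have products: "computes (4 * Suc (2 ^ r))
      (\<lambda>ys. product_list (2 ^ r) 0 2 1 3 ys @ product_list (2 ^ r) 0 3 1 2 ys)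
      (Suc (2 ^ r) + dct_additions r + (Suc (2 ^ r) + dct_additions r))
      (3 * Suc (2 ^ r) + dct_multiplications r + (3 * Suc (2 ^ r) + dct_multiplications r))"
    by (intro computes_append computes_product_list) simp_all
  note eig = computes_eigval_list[of _ r]
  have eigvals: "computes (4 * (2 * 2 ^ r))
      (\<lambda>xs. eigval_list (2 ^ r) 0 xs @ eigval_list (2 ^ r) 1 xs @ eigval_list (2 ^ r) 2 xs @ eigval_list (2 ^ r) 3 xs)
      (4 * dct_additions r) (4 * (Suc (2 ^ r) + dct_multiplications r))"
    by (intro computes_cong[OF computes_append[OF eig[of 0] computes_append[OF eig[of 1]
          computes_append[OF eig[of 2] eig[of 3]]]]]) simp_all
  from computes_comp[OF eigvals products] show ?thesis
    by (rule computes_cong) (simp_all add: gamma_product_list_def Let_def eigval_list_def del: upt_Suc)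
qed

lemma eigval_list_eq:
  assumes "N > 0" "\<And>l. l < 2 * N \<Longrightarrow> xs ! (q * (2 * N) + l) = cos_sum N \<mu> l"
  shows "eigval_list N q xs = map \<mu> [0..<Suc N]"
proof (rule nth_equalityI)
  fix k assume "k < length (eigval_list N q xs)"
  then have k: "k \<le> N" by (simp add: eigval_list_def)
  then have "eigval_list N q xs ! k
      = (\<Sum>l\<le>N. end_weight N l * xs ! (q * (2 * N) + l) * cos (pi * real l * real k / real N))"
    by (simp add: eigval_list_def nth_dct del: upt_Suc)
  also have "\<dots> = (\<Sum>l\<le>N. end_weight N l * cos_sum N \<mu> l * cos (pi * real l * real k / real N))"
    using assms by (intro sum.cong) simp_all
  also have "\<dots> = \<mu> k" using assms(1) k by (rule cos_sum_inverse)
  finally show "eigval_list N q xs ! k = map \<mu> [0..<Suc N] ! k" using k by (simp del: upt_Suc)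
qed (simp add: eigval_list_def)

lemma product_list_eq:
  assumes "N > 0"
    and "\<And>j. j \<le> N \<Longrightarrow> ys ! (p * Suc N + j) * ys ! (q * Suc N + j)
      + ys ! (p' * Suc N + j) * ys ! (q' * Suc N + j) = \<mu> j"
  shows "product_list N p q p' q' ys = map (cos_sum N \<mu>) [0..<2 * N]"
proof -
  have "dct N (map (\<lambda>j. end_weight N j / real (2 * N)
        * (ys ! (p * Suc N + j) * ys ! (q * Suc N + j) + ys ! (p' * Suc N + j) * ys ! (q' * Suc N + j)))
        [0..<Suc N]) ! k = cos_sum N \<mu> k" if "k \<le> N" for k
    using that assms(2) by (simp add: nth_dct cos_sum_def del: upt_Suc mult_Suc_right)
  then show ?thesis
    using cos_sum_reflect[OF assms(1), of _ \<mu>] by (simp add: product_list_def Let_def)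
qed

lemma gamma_product_list_eq:
  assumes "N > 0"
    and c: "a1 \<in> carrier_vec (2 * N)" "b1 \<in> carrier_vec (2 * N)"
      "a2 \<in> carrier_vec (2 * N)" "b2 \<in> carrier_vec (2 * N)"
  defines "A1 \<equiv> gamma_mat (2 * N) a1" and "B1 \<equiv> gamma_mat (2 * N) b1"
    and "A2 \<equiv> gamma_mat (2 * N) a2" and "B2 \<equiv> gamma_mat (2 * N) b2"
  shows "gamma_product_list N (first_row A1 @ first_row B1 @ first_row A2 @ first_row B2)
    = list_of_vec (Q_mat (2 * N) *\<^sub>v (s_vec (2 * N) A1 A2 + s_vec (2 * N) B1 B2))
      @ list_of_vec (Q_mat (2 * N) *\<^sub>v (s_vec (2 * N) A1 B2 + s_vec (2 * N) B1 A2))"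
proof -
  let ?xs = "first_row A1 @ first_row B1 @ first_row A2 @ first_row B2"
  let ?ys = "map (($) a1) [0..<Suc N] @ map (($) b1) [0..<Suc N] @ map (($) a2) [0..<Suc N]
    @ map (($) b2) [0..<Suc N]"
  note rows = A1_def B1_def A2_def B2_def first_row_gamma_mat[OF assms(1)]
  have eig: "eigval_list N 0 ?xs = map (($) a1) [0..<Suc N]" "eigval_list N 1 ?xs = map (($) b1) [0..<Suc N]"
    "eigval_list N 2 ?xs = map (($) a2) [0..<Suc N]" "eigval_list N 3 ?xs = map (($) b2) [0..<Suc N]"
    by (intro eigval_list_eq; simp add: rows nth_append assms(1))+
  have "product_list N 0 2 1 3 ?ys = map (cos_sum N (\<lambda>j. a1 $ j * a2 $ j + b1 $ j * b2 $ j)) [0..<2 * N]"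
    "product_list N 0 3 1 2 ?ys = map (cos_sum N (\<lambda>j. a1 $ j * b2 $ j + b1 $ j * a2 $ j)) [0..<2 * N]"
    by (intro product_list_eq; simp add: nth_append assms(1) del: upt_Suc)+
  then show ?thesis
    unfolding gamma_product_list_def Let_def eig
    unfolding A1_def B1_def A2_def B2_def
    by (simp add: Q_mat_mult_s_vec[OF assms(1)] c list_of_vec_vec del: upt_Suc)
qed

text \<open>Eigenvalues multiply pointwise, and symmetric and asymmetric vectors multiply like even
  and odd functions: a1 a2 + b1 b2 is the symmetric part of the product, giving the circulant, and
  a1 b2 + b1 a2 the asymmetric part, giving the reverse circulant.\<close>

lemma gamma_mat_product:
  assumes N: "N > 0"
    and c: "a1 \<in> carrier_vec (2 * N)" "b1 \<in> carrier_vec (2 * N)"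
      "a2 \<in> carrier_vec (2 * N)" "b2 \<in> carrier_vec (2 * N)"
    and sym: "symmetric_vec a1" "symmetric_vec a2"
    and asym: "asymmetric_vec b1" "asymmetric_vec b2"
  defines "A1 \<equiv> gamma_mat (2 * N) a1" and "B1 \<equiv> gamma_mat (2 * N) b1"
    and "A2 \<equiv> gamma_mat (2 * N) a2" and "B2 \<equiv> gamma_mat (2 * N) b2"
  shows "(A1 + B1) * (A2 + B2)
    = circ (Q_mat (2 * N) *\<^sub>v (s_vec (2 * N) A1 A2 + s_vec (2 * N) B1 B2))
      + rcirc (Q_mat (2 * N) *\<^sub>v (s_vec (2 * N) A1 B2 + s_vec (2 * N) B1 A2))"
proof -
  let ?n = "2 * N"
  define u where "u = vec ?n (\<lambda>j. a1 $ j * a2 $ j + b1 $ j * b2 $ j)"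
  define v where "v = vec ?n (\<lambda>j. a1 $ j * b2 $ j + b1 $ j * a2 $ j)"
  have uv: "u \<in> carrier_vec ?n" "v \<in> carrier_vec ?n" by (simp_all add: u_def v_def)
  have reflect: "a1 $ j = a1 $ ((?n - j) mod ?n)" "a2 $ j = a2 $ ((?n - j) mod ?n)"
    "b1 $ j = - b1 $ ((?n - j) mod ?n)" "b2 $ j = - b2 $ ((?n - j) mod ?n)" if "j < ?n" for j
    using sym asym that unfolding symmetric_vec_def asymmetric_vec_def c[THEN carrier_vecD] by blast+
  have "u $ j = u $ ((?n - j) mod ?n) \<and> v $ j = - v $ ((?n - j) mod ?n)" if "j < ?n" for j
  proof -
    have "(?n - j) mod ?n < ?n" using N by simp
    then show ?thesis
      unfolding u_def v_def index_vec[OF that] index_vec[OF \<open>(?n - j) mod ?n < ?n\<close>] reflect[OF that]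
      by simp
  qed
  then have "symmetric_vec u" "asymmetric_vec v"
    unfolding symmetric_vec_def asymmetric_vec_def uv[THEN carrier_vecD] by blast+
  have "(A1 + B1) * (A2 + B2) = gamma_mat ?n (a1 + b1) * gamma_mat ?n (a2 + b2)"
    unfolding A1_def B1_def A2_def B2_def using c by (simp add: gamma_mat_add)
  also have "\<dots> = gamma_mat ?n (vec ?n (\<lambda>j. (a1 + b1) $ j * (a2 + b2) $ j))"
    by (rule gamma_mat_mult[OF N])
  also have "vec ?n (\<lambda>j. (a1 + b1) $ j * (a2 + b2) $ j) = u + v"
    using c by (intro eq_vecI) (auto simp: u_def v_def algebra_simps)
  also have "gamma_mat ?n (u + v) = gamma_mat ?n u + gamma_mat ?n v"
    by (rule gamma_mat_add[OF uv, symmetric])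
  also have "gamma_mat ?n u = circ (vec ?n (cos_sum N (\<lambda>j. a1 $ j * a2 $ j + b1 $ j * b2 $ j)))"
    unfolding gamma_mat_symmetric[OF N uv(1) \<open>symmetric_vec u\<close>]
    using N by (subst cos_sum_cong) (auto simp: u_def)
  also have "gamma_mat ?n v = rcirc (vec ?n (cos_sum N (\<lambda>j. a1 $ j * b2 $ j + b1 $ j * a2 $ j)))"
    unfolding gamma_mat_asymmetric[OF N uv(2) \<open>asymmetric_vec v\<close>]
    using N by (subst cos_sum_cong) (auto simp: v_def)
  finally show ?thesis
    unfolding A1_def B1_def A2_def B2_def by (simp add: Q_mat_mult_s_vec[OF N] c)
qed

section \<open>Asymptotics and the final program\<close>

lemma affine_smallo_n_log_n:
  "(\<lambda>r. c * real (2 ^ r) + d) \<in> o(\<lambda>r. real (2 ^ r) * log 2 (real (2 ^ r)))"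
proof (rule landau_o.smallI)
  fix e :: real assume e: "e > 0"
  show "\<forall>\<^sub>F r in at_top. norm (c * real (2 ^ r) + d) \<le> e * norm (real (2 ^ r) * log 2 (real (2 ^ r)))"
    \<comment> \<open>From this threshold on, |c| + |d| is at most e r, where r is the logarithm;
      the constant d is absorbed because 2^r is at least 1.\<close>
    using eventually_ge_at_top[of "nat \<lceil>(\<bar>c\<bar> + \<bar>d\<bar>) / e\<rceil>"]
  proof eventually_elim
    case (elim r)
    then have "(\<bar>c\<bar> + \<bar>d\<bar>) / e \<le> real r" by linarith
    then have r: "\<bar>c\<bar> + \<bar>d\<bar> \<le> e * real r" using e by (simp add: field_simps)
    have "norm (c * real (2 ^ r) + d) \<le> \<bar>c\<bar> * 2 ^ r + \<bar>d\<bar> * 1"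
      using abs_triangle_ineq[of "c * 2 ^ r" d] by (simp add: abs_mult)
    also have "\<dots> \<le> \<bar>c\<bar> * 2 ^ r + \<bar>d\<bar> * 2 ^ r"
      by (intro add_left_mono mult_left_mono) simp_all
    also have "\<dots> \<le> e * real r * 2 ^ r"
      using mult_right_mono[OF r, of "2 ^ r"] by (simp add: distrib_right)
    also have "\<dots> = e * norm (real (2 ^ r) * log 2 (real (2 ^ r)))"
      by (simp add: log_nat_power abs_mult)
    finally show ?case .
  qed
qed

text \<open>With N = n / 2 the counts are 9 N s + 8 N + 8 and 3 N s + 10 N + 10, where s = log n -
  1. Replacing s turns the linear terms into -n / 2 and 7 n / 2.\<close>

lemma gamma_product_program:
  fixes r :: nat
  assumes "r \<ge> 2"
  defines "n \<equiv> 2 ^ r"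
  shows "\<exists>P. well_formed (4 * n) P \<and>
    real (num_additions P) = 9 / 2 * real n * log 2 (real n) + (- 1 / 2 * real n + 8) \<and>
    real (num_multiplications P) = 3 / 2 * real n * log 2 (real n) + (7 / 2 * real n + 10) \<and>
    (\<forall>C1 B1 C2 B2. C1 \<in> gamma_mats n \<and> B1 \<in> gamma_mats n \<and> C2 \<in> gamma_mats n \<and> B2 \<in> gamma_mats n \<longrightarrow>
      slp_output P (first_row C1 @ first_row B1 @ first_row C2 @ first_row B2)
      = list_of_vec (Q_mat n *\<^sub>v (s_vec n C1 C2 + s_vec n B1 B2))
        @ list_of_vec (Q_mat n *\<^sub>v (s_vec n C1 B2 + s_vec n B1 C2)))"
proof -
  obtain s where s: "r = Suc s" using assms(1) by (cases r) auto
  define N :: nat where "N = 2 ^ s"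
  have N: "N > 0" "n = 2 * N" by (simp_all add: N_def n_def s)
  have "log 2 (real n) = real r" by (simp add: n_def log_nat_power)
  then have log: "log 2 (real n) = real s + 1" by (simp add: s)
  obtain P where wf: "well_formed (4 * (2 * N)) P"
    and adds: "num_additions P = 6 * dct_additions s + 2 * Suc N"
    and mults: "num_multiplications P = 6 * dct_multiplications s + 10 * Suc N"
    and out: "\<And>xs. length xs = 4 * (2 * N) \<Longrightarrow> slp_output P xs = gamma_product_list N xs"
    using computes_gamma_product_list[of s] unfolding computes_def N_def by blast
  have "real (num_additions P) = 9 / 2 * real n * log 2 (real n) + (- 1 / 2 * real n + 8)"
    unfolding adds log unfolding N(2) by (simp add: dct_additions_eq N_def algebra_simps)
  moreover
  have "real (num_multiplications P) = 3 / 2 * real n * log 2 (real n) + (7 / 2 * real n + 10)"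
    unfolding mults log unfolding N(2) by (simp add: dct_multiplications_eq N_def algebra_simps)
  moreover
  have "slp_output P (first_row C1 @ first_row B1 @ first_row C2 @ first_row B2)
      = list_of_vec (Q_mat n *\<^sub>v (s_vec n C1 C2 + s_vec n B1 B2))
        @ list_of_vec (Q_mat n *\<^sub>v (s_vec n C1 B2 + s_vec n B1 C2))"
    if "C1 \<in> gamma_mats n \<and> B1 \<in> gamma_mats n \<and> C2 \<in> gamma_mats n \<and> B2 \<in> gamma_mats n"
    for C1 B1 C2 B2
  proof -
    from that obtain a1 b1 a2 b2 where
      "C1 = gamma_mat n a1" "B1 = gamma_mat n b1" "C2 = gamma_mat n a2" "B2 = gamma_mat n b2"
      "a1 \<in> carrier_vec n" "b1 \<in> carrier_vec n" "a2 \<in> carrier_vec n" "b2 \<in> carrier_vec n"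
      unfolding gamma_mats_def by blast
    moreover from this have
      "length (first_row C1 @ first_row B1 @ first_row C2 @ first_row B2) = 4 * (2 * N)"
      using N by (simp add: first_row_gamma_mat)
    ultimately show ?thesis
      using N by (simp only: out gamma_product_list_eq)
  qed
  ultimately show ?thesis using wf unfolding N(2)[symmetric] by blast
qed

lemma gamma_mats_superset:
  "sym_gamma_mats n \<subseteq> gamma_mats n" "asym_gamma_mats n \<subseteq> gamma_mats n"
  unfolding sym_gamma_mats_def asym_gamma_mats_def gamma_mats_def by blast+

theorem theorem5p2:
  shows "(\<forall>r\<ge>2. \<forall>n G1 G2 C1 B1 C2 B2.
      n = 2 ^ r \<and> G1 \<in> gamma_mats n \<and> G2 \<in> gamma_mats n \<and>
      C1 \<in> sym_gamma_mats n \<and> B1 \<in> asym_gamma_mats n \<and> G1 = C1 + B1 \<and>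
      C2 \<in> sym_gamma_mats n \<and> B2 \<in> asym_gamma_mats n \<and> G2 = C2 + B2 \<longrightarrow>
      G1 * G2 = circ (Q_mat n *\<^sub>v (s_vec n C1 C2 + s_vec n B1 B2))
              + rcirc (Q_mat n *\<^sub>v (s_vec n C1 B2 + s_vec n B1 C2)))
    \<and>
    (\<exists>(P :: nat \<Rightarrow> slp) (ea :: nat \<Rightarrow> real) (em :: nat \<Rightarrow> real).
      (\<lambda>r. ea (2 ^ r)) \<in> o(\<lambda>r. real (2 ^ r) * log 2 (real (2 ^ r))) \<and>
      (\<lambda>r. em (2 ^ r)) \<in> o(\<lambda>r. real (2 ^ r) * log 2 (real (2 ^ r))) \<and>
      (\<forall>r\<ge>2. \<forall>n. n = 2 ^ r \<longrightarrow>
        well_formed (4 * n) (P n) \<and>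
        real (num_additions (P n)) = 9 / 2 * real n * log 2 (real n) + ea n \<and>
        real (num_multiplications (P n)) = 3 / 2 * real n * log 2 (real n) + em n \<and>
        (\<forall>G1 G2 C1 B1 C2 B2.
          G1 \<in> gamma_mats n \<and> G2 \<in> gamma_mats n \<and>
          C1 \<in> sym_gamma_mats n \<and> B1 \<in> asym_gamma_mats n \<and> G1 = C1 + B1 \<and>
          C2 \<in> sym_gamma_mats n \<and> B2 \<in> asym_gamma_mats n \<and> G2 = C2 + B2 \<longrightarrow>
          slp_output (P n) (first_row C1 @ first_row B1 @ first_row C2 @ first_row B2)
            = list_of_vec (Q_mat n *\<^sub>v (s_vec n C1 C2 + s_vec n B1 B2))
              @ list_of_vec (Q_mat n *\<^sub>v (s_vec n C1 B2 + s_vec n B1 C2)))))"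
  (is "?product \<and> ?program")
proof
  show ?product
  proof (intro allI impI, elim conjE)
    fix r n :: nat and G1 G2 C1 B1 C2 B2
    assume r: "2 \<le> r" and n: "n = 2 ^ r"
      and C: "C1 \<in> sym_gamma_mats n" "C2 \<in> sym_gamma_mats n"
      and B: "B1 \<in> asym_gamma_mats n" "B2 \<in> asym_gamma_mats n"
      and G: "G1 = C1 + B1" "G2 = C2 + B2"
    obtain s where "r = Suc s" using r by (cases r) auto
    then have N: "n = 2 * 2 ^ s" "(2 :: nat) ^ s > 0" using n by simp_all
    show "G1 * G2 = circ (Q_mat n *\<^sub>v (s_vec n C1 C2 + s_vec n B1 B2))
        + rcirc (Q_mat n *\<^sub>v (s_vec n C1 B2 + s_vec n B1 C2))"
      using C B gamma_mat_product[OF N(2)] unfolding G sym_gamma_mats_def asym_gamma_mats_def N(1)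
      by blast
  qed
  \<comment> \<open>The programs are indexed by \<open>n\<close> rather than by its exponent, so a
    value is also required when \<open>n\<close> is not such a power of two; there any program
    serves.\<close>
  have "\<exists>P. \<forall>r\<ge>2. n = 2 ^ r \<longrightarrow> well_formed (4 * n) P \<and>
      real (num_additions P) = 9 / 2 * real n * log 2 (real n) + (- 1 / 2 * real n + 8) \<and>
      real (num_multiplications P) = 3 / 2 * real n * log 2 (real n) + (7 / 2 * real n + 10) \<and>
      (\<forall>C1 B1 C2 B2. C1 \<in> gamma_mats n \<and> B1 \<in> gamma_mats n \<and> C2 \<in> gamma_mats n \<and> B2 \<in> gamma_mats n \<longrightarrow>
        slp_output P (first_row C1 @ first_row B1 @ first_row C2 @ first_row B2)
        = list_of_vec (Q_mat n *\<^sub>v (s_vec n C1 C2 + s_vec n B1 B2))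
          @ list_of_vec (Q_mat n *\<^sub>v (s_vec n C1 B2 + s_vec n B1 C2)))" for n :: nat
  proof (cases "\<exists>r\<ge>2. n = 2 ^ r")
    case True
    then obtain r where "r \<ge> 2" "n = 2 ^ r" by blast
    then show ?thesis using gamma_product_program[of r] by blast
  qed blast
  then obtain P where P: "\<forall>n. \<forall>r\<ge>2. n = 2 ^ r \<longrightarrow> well_formed (4 * n) (P n) \<and>
      real (num_additions (P n)) = 9 / 2 * real n * log 2 (real n) + (- 1 / 2 * real n + 8) \<and>
      real (num_multiplications (P n)) = 3 / 2 * real n * log 2 (real n) + (7 / 2 * real n + 10) \<and>
      (\<forall>C1 B1 C2 B2. C1 \<in> gamma_mats n \<and> B1 \<in> gamma_mats n \<and> C2 \<in> gamma_mats n \<and> B2 \<in> gamma_mats n \<longrightarrow>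
        slp_output (P n) (first_row C1 @ first_row B1 @ first_row C2 @ first_row B2)
        = list_of_vec (Q_mat n *\<^sub>v (s_vec n C1 C2 + s_vec n B1 B2))
          @ list_of_vec (Q_mat n *\<^sub>v (s_vec n C1 B2 + s_vec n B1 C2)))"
    by metis
  show ?program
  proof (intro exI conjI allI impI)
    \<comment> \<open>These two bounds fix the witnesses \<open>ea\<close> and \<open>em\<close> as
      -n / 2 + 8 and 7 n / 2 + 10.\<close>
    show "(\<lambda>r. - 1 / 2 * real (2 ^ r) + 8) \<in> o(\<lambda>r. real (2 ^ r) * log 2 (real (2 ^ r)))"
      "(\<lambda>r. 7 / 2 * real (2 ^ r) + 10) \<in> o(\<lambda>r. real (2 ^ r) * log 2 (real (2 ^ r)))"
      by (rule affine_smallo_n_log_n)+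
  next
    fix r n :: nat assume "2 \<le> r" "n = 2 ^ r"
    note program = P[rule_format, OF this]
    show "well_formed (4 * n) (P n)"
      "real (num_additions (P n)) = 9 / 2 * real n * log 2 (real n) + (- 1 / 2 * real n + 8)"
      "real (num_multiplications (P n)) = 3 / 2 * real n * log 2 (real n) + (7 / 2 * real n + 10)"
      using program by blast+
    fix G1 G2 C1 B1 C2 B2
    assume "G1 \<in> gamma_mats n \<and> G2 \<in> gamma_mats n \<and>
      C1 \<in> sym_gamma_mats n \<and> B1 \<in> asym_gamma_mats n \<and> G1 = C1 + B1 \<and>
      C2 \<in> sym_gamma_mats n \<and> B2 \<in> asym_gamma_mats n \<and> G2 = C2 + B2"
    then show "slp_output (P n) (first_row C1 @ first_row B1 @ first_row C2 @ first_row B2)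
        = list_of_vec (Q_mat n *\<^sub>v (s_vec n C1 C2 + s_vec n B1 B2))
          @ list_of_vec (Q_mat n *\<^sub>v (s_vec n C1 B2 + s_vec n B1 C2))"
      using program gamma_mats_superset by blast
  qed
qed

end
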